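(* For every $\mathbf t=(t_1,t_2)\in\mathbb Z^2$, the product $$\prod_p\big(1+(t_1,t_2)'_p\big)$$ over all primes $p$ has only finitely many factors different from one. It is either $0$ or a power of $2$. It is not equal to $0$ if and only if the conic defined by $t_1x^2+t_2y^2=z^2$ in $\mathbb P^2$ has a rational point.
   Context: A rational point is a $\mathbb Q$-point; the conic may be degenerate; $1=2^0$ counts as a power of $2$. For $a,b\in\mathbb Q_p^\times$ the Hilbert symbol $(a,b)_{\mathbb Q_p}\in\{\pm1\}$ is $1$ if the plane conic $z^2=ax^2+by^2$ has a $\mathbb Q_p$-rational point and $-1$ otherwise. For a prime $p$ and $t_1,t_2\in\mathbb Q_p$ define $(t_1,t_2)'_p\in\{-1,0,1\}\subseteq\mathbb{Z}$ to be: $0$ if $t_1=0$ or $t_2=0$; $0$ if $p$ is odd and $v_p(t_1),v_p(t_2)$ are both even; $0$ if $p=2$, $v_2(t_1),v_2(t_2)$ are both even and $t_1/2^{v_2(t_1)}\not\equiv t_2/2^{v_2(t_2)}\bmod4$; and $(t_1,t_2)_{\mathbb Q_p}$ otherwise. $\mathbb Z$ is regarded as a subset of $\mathbb Z_p$. *)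

theory Defs
  imports "HOL-Algebra.QuotRing" "HOL-Computational_Algebra.Primes" Complex_Main
begin

section \<open>The field of p-adic numbers as the completion of the rationals\<close>

text \<open>
  Since the prime is quantified over inside statements, the p-adic numbers are not a type but an
  explicit ring: Cauchy sequences of rationals with respect to the p-adic absolute value, modulo
  null sequences. Its elements are cosets, i.e. sets of sequences.
\<close>

text \<open>The valuation of a nonzero rational; the value at \<open>0\<close> is junk and never relevant.\<close>

definition rat_val :: "nat \<Rightarrow> rat \<Rightarrow> int" where
  "rat_val p x = int (multiplicity (int p) (fst (quotient_of x)))
               - int (multiplicity (int p) (snd (quotient_of x)))"

definition rat_pabs :: "nat \<Rightarrow> rat \<Rightarrow> real" where
  "rat_pabs p x = (if x = 0 then 0 else real p powi (- rat_val p x))"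

definition pCauchy :: "nat \<Rightarrow> (nat \<Rightarrow> rat) \<Rightarrow> bool" where
  "pCauchy p X \<longleftrightarrow> (\<forall>e>0. \<exists>N. \<forall>m\<ge>N. \<forall>n\<ge>N. rat_pabs p (X m - X n) < e)"

definition pnull :: "nat \<Rightarrow> (nat \<Rightarrow> rat) set" where
  "pnull p = {X. (\<lambda>n. rat_pabs p (X n)) \<longlonglongrightarrow> 0}"

definition pCauchy_ring :: "nat \<Rightarrow> (nat \<Rightarrow> rat) ring" where
  "pCauchy_ring p =
     \<lparr>carrier = {X. pCauchy p X},
      monoid.mult = (\<lambda>X Y n. X n * Y n), monoid.one = (\<lambda>n. 1),
      ring.zero = (\<lambda>n. 0), ring.add = (\<lambda>X Y n. X n + Y n)\<rparr>"

definition Qp :: "nat \<Rightarrow> (nat \<Rightarrow> rat) set ring" where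
  "Qp p = pCauchy_ring p Quot pnull p"

definition Qp_of_rat :: "nat \<Rightarrow> rat \<Rightarrow> (nat \<Rightarrow> rat) set" where
  "Qp_of_rat p q = pnull p +>\<^bsub>pCauchy_ring p\<^esub> (\<lambda>n. q)"

text \<open>
  For a nonzero element, the valuations of the members of every representing sequence are
  eventually constant, with the same eventual value. At zero the definition gives junk.
\<close>

definition Qp_val :: "nat \<Rightarrow> (nat \<Rightarrow> rat) set \<Rightarrow> int" where
  "Qp_val p x = (THE k. \<forall>X\<in>x. \<forall>\<^sub>F n in sequentially. rat_val p (X n) = k)"

definition Zp :: "nat \<Rightarrow> (nat \<Rightarrow> rat) set set" where
  "Zp p = {x \<in> carrier (Qp p). x = \<zero>\<^bsub>Qp p\<^esub> \<or> Qp_val p x \<ge> 0}"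

definition Zp_cong :: "nat \<Rightarrow> (nat \<Rightarrow> rat) set \<Rightarrow> (nat \<Rightarrow> rat) set \<Rightarrow> int \<Rightarrow> bool" where
  "Zp_cong p x y m \<longleftrightarrow> (\<exists>c\<in>Zp p. x \<ominus>\<^bsub>Qp p\<^esub> y = Qp_of_rat p (of_int m) \<otimes>\<^bsub>Qp p\<^esub> c)"

text \<open>The unit \<open>x / p^v(x)\<close> for nonzero \<open>x\<close>.\<close>

definition Qp_unit_part :: "nat \<Rightarrow> (nat \<Rightarrow> rat) set \<Rightarrow> (nat \<Rightarrow> rat) set" where
  "Qp_unit_part p x = x \<otimes>\<^bsub>Qp p\<^esub> Qp_of_rat p (of_nat p powi (- Qp_val p x))"


section \<open>Hilbert symbols\<close>

definition hilbert_symbol :: "nat \<Rightarrow> (nat \<Rightarrow> rat) set \<Rightarrow> (nat \<Rightarrow> rat) set \<Rightarrow> int" where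
  "hilbert_symbol p a b =
     (if \<exists>x\<in>carrier (Qp p). \<exists>y\<in>carrier (Qp p). \<exists>z\<in>carrier (Qp p).
           (x, y, z) \<noteq> (\<zero>\<^bsub>Qp p\<^esub>, \<zero>\<^bsub>Qp p\<^esub>, \<zero>\<^bsub>Qp p\<^esub>) \<and>
           z [^]\<^bsub>Qp p\<^esub> (2::nat) =
             a \<otimes>\<^bsub>Qp p\<^esub> x [^]\<^bsub>Qp p\<^esub> (2::nat) \<oplus>\<^bsub>Qp p\<^esub> b \<otimes>\<^bsub>Qp p\<^esub> y [^]\<^bsub>Qp p\<^esub> (2::nat)
      then 1 else -1)"

definition hilbert_symbol' :: "nat \<Rightarrow> (nat \<Rightarrow> rat) set \<Rightarrow> (nat \<Rightarrow> rat) set \<Rightarrow> int" where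
  "hilbert_symbol' p t1 t2 =
     (if t1 = \<zero>\<^bsub>Qp p\<^esub> \<or> t2 = \<zero>\<^bsub>Qp p\<^esub> then 0
      else if odd p \<and> even (Qp_val p t1) \<and> even (Qp_val p t2) then 0
      else if p = 2 \<and> even (Qp_val p t1) \<and> even (Qp_val p t2) \<and>
              \<not> Zp_cong p (Qp_unit_part p t1) (Qp_unit_part p t2) 4 then 0
      else hilbert_symbol p t1 t2)"


section \<open>Soundness of the construction\<close>

text \<open>
  For prime \<open>p\<close>: \<open>Qp p\<close> is a field (\<open>Qp_field\<close>), \<open>Qp_val\<close> is well defined on nonzero elements
  (\<open>Qp_val_rep\<close>), and it extends the valuation of the rationals (\<open>Qp_val_of_rat\<close>).
\<close>

lemma rat_val_eq:
  assumes "prime p" "a \<noteq> 0" "b \<noteq> 0"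
  shows "rat_val p (of_int a / of_int b) = int (multiplicity (int p) a) - int (multiplicity (int p) b)"
proof -
  obtain c d where cd: "quotient_of (of_int a / of_int b) = (c, d)" by force
  have d: "d > 0" using quotient_of_denom_pos[OF cd] .
  have q: "(of_int a / of_int b :: rat) = of_int c / of_int d" using quotient_of_div[OF cd] .
  then have c: "c \<noteq> 0" using assms d by auto
  have "(of_int (a * d) :: rat) = of_int (c * b)" using q assms d by (simp add: field_simps)
  then have e: "a * d = c * b" by (simp only: of_int_eq_iff)
  have pp: "prime_elem (int p)" using assms by simp
  have "multiplicity (int p) a + multiplicity (int p) d = multiplicity (int p) c + multiplicity (int p) b"
    using e prime_elem_multiplicity_mult_distrib[OF pp] assms c d by (metis less_irrefl)
  then show ?thesis unfolding rat_val_def cd by simp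
qed

lemma rat_frac: "\<exists>a b. (x::rat) = of_int a / of_int b \<and> b \<noteq> 0"
  by (metis quotient_of_div quotient_of_denom_pos prod.exhaust less_irrefl)

lemma rat_val_mult:
  assumes "prime p" "x \<noteq> 0" "y \<noteq> 0"
  shows "rat_val p (x * y) = rat_val p x + rat_val p y"
proof -
  obtain a b where x: "x = of_int a / of_int b" "b \<noteq> 0" using rat_frac by blast
  obtain c d where y: "y = of_int c / of_int d" "d \<noteq> 0" using rat_frac by blast
  have ac: "a \<noteq> 0" "c \<noteq> 0" using assms x y by auto
  have pp: "prime_elem (int p)" using assms by simp
  have "x * y = of_int (a * c) / of_int (b * d)" by (simp add: x y)
  then show ?thesis using rat_val_eq[OF assms(1)] ac x y
    by (simp only: ) (simp add: prime_elem_multiplicity_mult_distrib[OF pp] del: of_int_mult)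
qed

lemma rat_val_minus [simp]: "rat_val p (- x) = rat_val p x"
  by (cases "quotient_of x") (simp add: rat_val_def rat_uminus_code multiplicity_def)

lemma rat_val_add:
  assumes "prime p" "x \<noteq> 0" "y \<noteq> 0" "x + y \<noteq> 0"
  shows "rat_val p (x + y) \<ge> min (rat_val p x) (rat_val p y)"
proof -
  obtain a b where x: "x = of_int a / of_int b" "b \<noteq> 0" using rat_frac by blast
  obtain c d where y: "y = of_int c / of_int d" "d \<noteq> 0" using rat_frac by blast
  have ac: "a \<noteq> 0" "c \<noteq> 0" using assms x y by auto
  have pp: "prime_elem (int p)" using assms by simp
  have nu: "\<not> is_unit (int p)" using assms(1) pp prime_elem_def by blast
  have s: "x + y = of_int (a * d + c * b) / of_int (b * d)" using x y by (simp add: field_simps)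
  then have nz: "a * d + c * b \<noteq> 0" using assms by (metis div_0 of_int_0)
  let ?m = "multiplicity (int p)"
  let ?k = "min (?m (a*d)) (?m (c*b))"
  have "int p ^ ?k dvd a * d + c * b"
    by (intro dvd_add multiplicity_dvd') auto
  then have "?k \<le> ?m (a * d + c * b)"
    by (intro multiplicity_geI) (use nz nu in auto)
  moreover have "rat_val p (x + y) = int (?m (a*d+c*b)) - int (?m (b*d))"
    unfolding s using rat_val_eq[OF assms(1) nz] x y by (simp del: of_int_mult of_int_add)
  moreover have "rat_val p x = int (?m a) - int (?m b)" "rat_val p y = int (?m c) - int (?m d)"
    using x y ac rat_val_eq[OF assms(1)] by auto
  ultimately show ?thesis using x y ac
    by (auto simp: prime_elem_multiplicity_mult_distrib[OF pp])
qed

lemma pabs_nonneg [simp]: "rat_pabs p x \<ge> 0" by (simp add: rat_pabs_def)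
lemma pabs_0 [simp]: "rat_pabs p 0 = 0" by (simp add: rat_pabs_def)
lemma pabs_minus [simp]: "rat_pabs p (- x) = rat_pabs p x" by (simp add: rat_pabs_def)
lemma pabs_pos: "prime p \<Longrightarrow> x \<noteq> 0 \<Longrightarrow> rat_pabs p x > 0"
  by (simp add: rat_pabs_def prime_gt_0_nat)
lemma pabs_mult: "prime p \<Longrightarrow> rat_pabs p (x * y) = rat_pabs p x * rat_pabs p y"
proof (cases "x = 0 \<or> y = 0")
  case False
  assume p: "prime p"
  have p0: "real p \<noteq> 0" using prime_gt_0_nat[OF p] by simp
  have "- rat_val p (x * y) = - rat_val p x + - rat_val p y" using False rat_val_mult[OF p] by simp
  then have "real p powi (- rat_val p (x * y)) = real p powi (- rat_val p x) * real p powi (- rat_val p y)"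
    using power_int_add[OF disjI1[OF p0]] by metis
  then show ?thesis using False by (simp add: rat_pabs_def)
qed (auto simp: rat_pabs_def)
lemma pabs_add: assumes "prime p" shows "rat_pabs p (x + y) \<le> max (rat_pabs p x) (rat_pabs p y)"
proof (cases "x = 0 \<or> y = 0 \<or> x + y = 0")
  case True then show ?thesis by (auto simp: max_def) 
next
  case False
  have p: "real p \<ge> 1" using prime_ge_1_nat[OF assms] by simp
  have "rat_val p x \<le> rat_val p (x+y) \<or> rat_val p y \<le> rat_val p (x+y)"
    using rat_val_add[OF assms, of x y] False by (auto simp: min_le_iff_disj)
  then show ?thesis
  proof
    assume "rat_val p x \<le> rat_val p (x+y)"
    then have "real p powi (- rat_val p (x+y)) \<le> real p powi (- rat_val p x)" by (intro power_int_increasing p) simp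
    then show ?thesis using False by (simp add: rat_pabs_def le_max_iff_disj)
  next
    assume "rat_val p y \<le> rat_val p (x+y)"
    then have "real p powi (- rat_val p (x+y)) \<le> real p powi (- rat_val p y)" by (intro power_int_increasing p) simp
    then show ?thesis using False by (simp add: rat_pabs_def le_max_iff_disj)
  qed
qed
lemma pabs_diff: assumes "prime p" shows "rat_pabs p (x - y) \<le> max (rat_pabs p x) (rat_pabs p y)"
  using pabs_add[OF assms, of x "-y"] by simp
lemma pabs_add': "prime p \<Longrightarrow> rat_pabs p (x + y) \<le> rat_pabs p x + rat_pabs p y"
  using pabs_add[of p x y] pabs_nonneg[of p x] pabs_nonneg[of p y] by linarith
lemma pabs_add_less: "prime p \<Longrightarrow> rat_pabs p x < e \<Longrightarrow> rat_pabs p y < e \<Longrightarrow> rat_pabs p (x + y) < e"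
  using pabs_add[of p x y] by linarith
lemma pabs_diff_less: "prime p \<Longrightarrow> rat_pabs p x < e \<Longrightarrow> rat_pabs p y < e \<Longrightarrow> rat_pabs p (x - y) < e"
  using pabs_diff[of p x y] by linarith
lemma pabs_1 [simp]: "rat_pabs p 1 = 1" by (simp add: rat_pabs_def rat_val_def)

lemma pCauchyD: "pCauchy p X \<Longrightarrow> e > 0 \<Longrightarrow> \<exists>N. \<forall>m\<ge>N. \<forall>n\<ge>N. rat_pabs p (X m - X n) < e"
  by (simp add: pCauchy_def)

lemma pCauchy_const: "pCauchy p (\<lambda>n. c)" by (auto simp: pCauchy_def)

lemma pCauchy_add: assumes "prime p" "pCauchy p X" "pCauchy p Y" shows "pCauchy p (\<lambda>n. X n + Y n)"
  unfolding pCauchy_def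
proof (intro allI impI)
  fix e :: real assume e: "e > 0"
  obtain N where N: "\<forall>m\<ge>N. \<forall>n\<ge>N. rat_pabs p (X m - X n) < e" using assms pCauchyD e by metis
  obtain M where M: "\<forall>m\<ge>M. \<forall>n\<ge>M. rat_pabs p (Y m - Y n) < e" using assms pCauchyD e by metis
  show "\<exists>N. \<forall>m\<ge>N. \<forall>n\<ge>N. rat_pabs p (X m + Y m - (X n + Y n)) < e"
  proof (intro exI[of _ "max N M"] allI impI)
    fix m n assume "m \<ge> max N M" "n \<ge> max N M"
    then have "rat_pabs p (X m - X n) < e" "rat_pabs p (Y m - Y n) < e" using N M by auto
    moreover have "rat_pabs p (X m + Y m - (X n + Y n)) \<le> max (rat_pabs p (X m - X n)) (rat_pabs p (Y m - Y n))"
      using pabs_add[OF assms(1), of "X m - X n" "Y m - Y n"] by (simp add: algebra_simps)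
    ultimately show "rat_pabs p (X m + Y m - (X n + Y n)) < e" by linarith
  qed
qed

lemma pCauchy_minus: "pCauchy p X \<Longrightarrow> pCauchy p (\<lambda>n. - X n)"
  unfolding pCauchy_def by (metis minus_diff_minus pabs_minus)

lemma pCauchy_bdd: assumes "prime p" "pCauchy p X" shows "\<exists>B>0. \<forall>n. rat_pabs p (X n) \<le> B"
proof -
  obtain N where N: "\<forall>m\<ge>N. \<forall>n\<ge>N. rat_pabs p (X m - X n) < 1" using pCauchyD[OF assms(2) zero_less_one] by auto
  define B where "B = 1 + (\<Sum>i\<le>N. rat_pabs p (X i))"
  have S: "rat_pabs p (X i) \<le> (\<Sum>i\<le>N. rat_pabs p (X i))" if "i \<le> N" for i
    using that by (intro member_le_sum) auto
  have "rat_pabs p (X n) \<le> B" for n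
  proof (cases "n \<le> N")
    case True then show ?thesis using S[OF True] by (simp add: B_def)
  next
    case False
    then have "rat_pabs p (X n - X N) < 1" using N by simp
    moreover have "rat_pabs p (X n) \<le> rat_pabs p (X n - X N) + rat_pabs p (X N)"
      using pabs_add'[OF assms(1), of "X n - X N" "X N"] by simp
    ultimately show ?thesis using S[of N] by (simp add: B_def)
  qed
  moreover have "B > 0" unfolding B_def by (simp add: add_pos_nonneg sum_nonneg)
  ultimately show ?thesis by blast
qed

lemma pCauchy_mult: assumes p: "prime p" "pCauchy p X" "pCauchy p Y" shows "pCauchy p (\<lambda>n. X n * Y n)"
  unfolding pCauchy_def
proof (intro allI impI)
  fix e :: real assume e: "e > 0"
  obtain B where B: "B > 0" "\<And>n. rat_pabs p (X n) \<le> B" using pCauchy_bdd p by blast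
  obtain C where C: "C > 0" "\<And>n. rat_pabs p (Y n) \<le> C" using pCauchy_bdd p by blast
  obtain N where N: "\<forall>m\<ge>N. \<forall>n\<ge>N. rat_pabs p (X m - X n) < e / C" using pCauchyD[OF p(2), of "e / C"] e C by auto
  obtain M where M: "\<forall>m\<ge>M. \<forall>n\<ge>M. rat_pabs p (Y m - Y n) < e / B" using pCauchyD[OF p(3), of "e / B"] e B by auto
  show "\<exists>N. \<forall>m\<ge>N. \<forall>n\<ge>N. rat_pabs p (X m * Y m - X n * Y n) < e"
  proof (intro exI[of _ "max N M"] allI impI)
    fix m n assume mn: "m \<ge> max N M" "n \<ge> max N M"
    have "rat_pabs p ((X m - X n) * Y m) \<le> rat_pabs p (X m - X n) * C"
      using C by (simp add: pabs_mult p mult_left_mono)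
    also have "\<dots> < e" using N mn C by (simp add: field_simps)
    finally have 1: "rat_pabs p ((X m - X n) * Y m) < e" .
    have "rat_pabs p (X n * (Y m - Y n)) \<le> B * rat_pabs p (Y m - Y n)"
      using B by (simp add: pabs_mult p mult_right_mono)
    also have "\<dots> < e" using M mn B by (simp add: field_simps)
    finally have 2: "rat_pabs p (X n * (Y m - Y n)) < e" .
    have "X m * Y m - X n * Y n = (X m - X n) * Y m + X n * (Y m - Y n)" by (simp add: algebra_simps)
    then show "rat_pabs p (X m * Y m - X n * Y n) < e" using pabs_add_less[OF p(1) 1 2] by simp
  qed
qed

lemma pCauchy_ring_simps [simp]:
  "X \<in> carrier (pCauchy_ring p) \<longleftrightarrow> pCauchy p X"
  "X \<otimes>\<^bsub>pCauchy_ring p\<^esub> Y = (\<lambda>n. X n * Y n)"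
  "X \<oplus>\<^bsub>pCauchy_ring p\<^esub> Y = (\<lambda>n. X n + Y n)"
  "\<one>\<^bsub>pCauchy_ring p\<^esub> = (\<lambda>n. 1)" "\<zero>\<^bsub>pCauchy_ring p\<^esub> = (\<lambda>n. 0)"
  by (simp_all add: pCauchy_ring_def)

lemma pCauchy_ring_cring: assumes "prime p" shows "cring (pCauchy_ring p)"
proof (rule cringI)
  show "abelian_group (pCauchy_ring p)"
  proof (rule abelian_groupI, goal_cases)
    case (6 x)
    then show ?case by (intro bexI[of _ "\<lambda>n. - x n"]) (simp_all add: pCauchy_minus)
  qed (simp_all only: pCauchy_ring_simps, simp_all add: pCauchy_const pCauchy_add[OF assms] fun_eq_iff)
  show "comm_monoid (pCauchy_ring p)"
    by (rule comm_monoidI) (simp_all only: pCauchy_ring_simps, simp_all add: pCauchy_const pCauchy_mult[OF assms] fun_eq_iff)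
qed (simp add: fun_eq_iff distrib_right)

lemma pnull_Cauchy: assumes p: "prime p" "X \<in> pnull p" shows "pCauchy p X"
  unfolding pCauchy_def
proof (intro allI impI)
  fix e :: real assume e: "e > 0"
  then have "\<forall>\<^sub>F n in sequentially. rat_pabs p (X n) < e"
    using p by (auto simp: pnull_def intro: order_tendstoD)
  then obtain N where "\<forall>n\<ge>N. rat_pabs p (X n) < e" by (auto simp: eventually_sequentially)
  then show "\<exists>N. \<forall>m\<ge>N. \<forall>n\<ge>N. rat_pabs p (X m - X n) < e" 
    by (intro exI[of _ N] allI impI pabs_diff_less[OF p(1)]) auto
qed

lemma pnull_squeeze: assumes "\<And>n. rat_pabs p (X n) \<le> f n" "f \<longlonglongrightarrow> 0" shows "X \<in> pnull p"
  unfolding pnull_def mem_Collect_eq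
  by (rule tendsto_sandwich[OF _ _ tendsto_const assms(2)]) (simp_all add: assms(1))

lemma pnull_add: assumes p: "prime p" "X \<in> pnull p" "Y \<in> pnull p" shows "(\<lambda>n. X n + Y n) \<in> pnull p"
proof -
  have "(\<lambda>n. rat_pabs p (X n) + rat_pabs p (Y n)) \<longlonglongrightarrow> 0" using p tendsto_add_zero unfolding pnull_def by blast
  then show ?thesis by (rule pnull_squeeze[rotated]) (rule pabs_add'[OF p(1)])
qed

lemma pnull_mult: assumes p: "prime p" "X \<in> pnull p" "pCauchy p Y" shows "(\<lambda>n. X n * Y n) \<in> pnull p"
proof -
  obtain C where C: "C > 0" "\<And>n. rat_pabs p (Y n) \<le> C" using pCauchy_bdd p by blast
  have "(\<lambda>n. rat_pabs p (X n) * C) \<longlonglongrightarrow> 0" using p tendsto_mult_left_zero unfolding pnull_def by blast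
  then show ?thesis by (rule pnull_squeeze[rotated]) (simp add: pabs_mult p C mult_left_mono)
qed

lemma pnull_minus: "X \<in> pnull p \<Longrightarrow> (\<lambda>n. - X n) \<in> pnull p" by (simp add: pnull_def)

lemma pnull_ideal: assumes p: "prime p" shows "ideal (pnull p) (pCauchy_ring p)"
proof -
  interpret R: cring "pCauchy_ring p" by (rule pCauchy_ring_cring[OF p])
  have inv: "inv\<^bsub>add_monoid (pCauchy_ring p)\<^esub> X = (\<lambda>n. - X n)" if "X \<in> pnull p" for X
    unfolding a_inv_def[symmetric]
    by (rule R.minus_equality) (simp_all add: pnull_Cauchy[OF p that] pCauchy_minus)
  show ?thesis
  proof (rule idealI)
    show "ring (pCauchy_ring p)" by (rule R.ring_axioms)
    show "subgroup (pnull p) (add_monoid (pCauchy_ring p))"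
    proof (rule subgroup.intro)
      show "pnull p \<subseteq> carrier (add_monoid (pCauchy_ring p))" using pnull_Cauchy[OF p] by auto
      show "\<one>\<^bsub>add_monoid (pCauchy_ring p)\<^esub> \<in> pnull p" by (simp add: pnull_def)
      show "inv\<^bsub>add_monoid (pCauchy_ring p)\<^esub> X \<in> pnull p" if "X \<in> pnull p" for X
        by (subst inv[OF that]) (rule pnull_minus[OF that])
    qed (simp add: pnull_add[OF p])
    show "Y \<otimes>\<^bsub>pCauchy_ring p\<^esub> X \<in> pnull p" if "X \<in> pnull p" "Y \<in> carrier (pCauchy_ring p)" for X Y
      using pnull_mult[OF p, of X Y] that by (simp add: mult.commute)
    show "X \<otimes>\<^bsub>pCauchy_ring p\<^esub> Y \<in> pnull p" if "X \<in> pnull p" "Y \<in> carrier (pCauchy_ring p)" for X Y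
      using pnull_mult[OF p, of X Y] that by simp
  qed
qed

lemma val_const:
  assumes p: "prime p" and X: "pCauchy p X" "X \<notin> pnull p"
  shows "\<exists>k. \<forall>Z\<in>pnull p. \<forall>\<^sub>F n in sequentially. Z n + X n \<noteq> 0 \<and> rat_val p (Z n + X n) = k"
proof -
  have "\<exists>e>0. \<forall>N. \<exists>n\<ge>N. rat_pabs p (X n) \<ge> e"
    using X(2) unfolding pnull_def mem_Collect_eq LIMSEQ_iff by (auto simp: not_less)
  then obtain e where e: "e > 0" "\<forall>N. \<exists>n\<ge>N. rat_pabs p (X n) \<ge> e" by blast
  obtain N where N: "\<forall>m\<ge>N. \<forall>n\<ge>N. rat_pabs p (X m - X n) < e" using pCauchyD[OF X(1) e(1)] by auto
  obtain M where M: "M \<ge> N" "rat_pabs p (X M) \<ge> e" using e by blast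
  have M0: "X M \<noteq> 0" using M e by auto
  have p1: "real p > 1" using prime_gt_1_nat[OF p] by simp
  show ?thesis
  proof (intro exI[of _ "rat_val p (X M)"] ballI)
    fix Z assume Z: "Z \<in> pnull p"
    have "\<forall>\<^sub>F n in sequentially. rat_pabs p (Z n) < e" using Z e by (auto simp: pnull_def intro: order_tendstoD)
    with eventually_ge_at_top[of N] show "\<forall>\<^sub>F n in sequentially. Z n + X n \<noteq> 0 \<and> rat_val p (Z n + X n) = rat_val p (X M)"
    proof eventually_elim
      case (elim n)
      define d where "d = Z n + X n - X M"
      have "rat_pabs p d \<le> max (rat_pabs p (Z n)) (rat_pabs p (X n - X M))"
        using pabs_add[OF p, of "Z n" "X n - X M"] by (simp add: d_def algebra_simps)
      then have d: "rat_pabs p d < rat_pabs p (X M)" using elim N M by fastforce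
      have s: "Z n + X n = X M + d" by (simp add: d_def)
      have a: "rat_pabs p (X M + d) \<le> rat_pabs p (X M)" using pabs_add[OF p, of "X M" d] d by linarith
      have b: "rat_pabs p (X M) \<le> rat_pabs p (X M + d)" using pabs_diff[OF p, of "X M + d" d] d by auto
      have eq: "rat_pabs p (X M + d) = rat_pabs p (X M)" using a b by simp
      then have nz: "X M + d \<noteq> 0" using pabs_pos[OF p M0] by auto
      have e2: "real p powi (- rat_val p (X M + d)) = real p powi (- rat_val p (X M))"
        using eq nz M0 by (simp only: rat_pabs_def if_False)
      have "rat_val p (X M + d) = rat_val p (X M)"
        using e2 power_int_strict_increasing[OF _ p1] by (metis less_irrefl linorder_neqE neg_equal_iff_equal)
      with nz show ?case by (simp add: s)
    qed
  qed
qed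

lemma pnull_rcos: assumes "prime p" shows "pnull p +>\<^bsub>pCauchy_ring p\<^esub> X = {\<lambda>n. Z n + X n |Z. Z \<in> pnull p}"
  by (auto simp: a_r_coset_def r_coset_def pCauchy_ring_def)

lemma Qp_val_rep:
  assumes p: "prime p" and X: "pCauchy p X" "X \<notin> pnull p"
  shows "\<forall>Y\<in>pnull p +>\<^bsub>pCauchy_ring p\<^esub> X. \<forall>\<^sub>F n in sequentially. 
    rat_val p (Y n) = Qp_val p (pnull p +>\<^bsub>pCauchy_ring p\<^esub> X)"
proof -
  obtain k where k: "\<forall>Z\<in>pnull p. \<forall>\<^sub>F n in sequentially. Z n + X n \<noteq> 0 \<and> rat_val p (Z n + X n) = k"
    using val_const assms by blast
  have K: "\<forall>Y\<in>pnull p +>\<^bsub>pCauchy_ring p\<^esub> X. \<forall>\<^sub>F n in sequentially. rat_val p (Y n) = k"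
    using k by (auto simp: pnull_rcos[OF p] elim: eventually_mono)
  have z: "(\<lambda>n. 0 + X n) \<in> pnull p +>\<^bsub>pCauchy_ring p\<^esub> X"
    unfolding pnull_rcos[OF p] mem_Collect_eq by (rule exI[of _ "\<lambda>n. 0"]) (simp add: pnull_def)
  show ?thesis unfolding Qp_val_def
  proof (rule theI[where a = k and P = "\<lambda>k. \<forall>Y\<in>pnull p +>\<^bsub>pCauchy_ring p\<^esub> X. \<forall>\<^sub>F n in sequentially. rat_val p (Y n) = k"], rule K)
    fix j assume J: "\<forall>Y\<in>pnull p +>\<^bsub>pCauchy_ring p\<^esub> X. \<forall>\<^sub>F n in sequentially. rat_val p (Y n) = j"
    have "\<forall>\<^sub>F n in sequentially. rat_val p (0 + X n) = j" by (rule bspec[OF J z])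
    moreover have "\<forall>\<^sub>F n in sequentially. rat_val p (0 + X n) = k" by (rule bspec[OF K z])
    ultimately have "\<forall>\<^sub>F n::nat in sequentially. j = k" by eventually_elim simp
    then show "j = k" by simp
  qed
qed

lemma Qp_val_of_rat:
  assumes p: "prime p" and q: "q \<noteq> 0"
  shows "Qp_val p (Qp_of_rat p q) = rat_val p q"
proof -
  have nn: "(\<lambda>n. q) \<notin> pnull p" using pabs_pos[OF p q] by (auto simp: pnull_def LIMSEQ_const_iff)
  have z: "(\<lambda>n. q) \<in> pnull p +>\<^bsub>pCauchy_ring p\<^esub> (\<lambda>n. q)"
    unfolding pnull_rcos[OF p] mem_Collect_eq by (rule exI[of _ "\<lambda>n. 0"]) (simp add: pnull_def)
  have "\<forall>\<^sub>F n::nat in sequentially. rat_val p q = Qp_val p (Qp_of_rat p q)"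
    using bspec[OF Qp_val_rep[OF p pCauchy_const nn] z] by (simp only: Qp_of_rat_def)
  then show ?thesis by simp
qed


lemma Qp_field: assumes p: "prime p" shows "field (Qp p)"
proof -
  let ?R = "pCauchy_ring p"
  interpret I: ideal "pnull p" ?R by (rule pnull_ideal[OF p])
  interpret Q: cring "Qp p" unfolding Qp_def by (rule I.quotient_is_cring[OF pCauchy_ring_cring[OF p]])
  have zero: "\<zero>\<^bsub>Qp p\<^esub> = pnull p" by (simp add: Qp_def FactRing_def)
  have one: "\<one>\<^bsub>Qp p\<^esub> = pnull p +>\<^bsub>?R\<^esub> (\<lambda>n. 1)" by (simp add: Qp_def FactRing_def)
  have nz: "\<one>\<^bsub>Qp p\<^esub> \<noteq> \<zero>\<^bsub>Qp p\<^esub>"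
  proof
    assume "\<one>\<^bsub>Qp p\<^esub> = \<zero>\<^bsub>Qp p\<^esub>"
    then have "(\<lambda>n. 1) \<in> pnull p"
      using I.a_rcos_self[of "\<lambda>n. 1"] by (simp add: zero one pCauchy_const)
    then show False by (simp add: pnull_def LIMSEQ_const_iff)
  qed
  show ?thesis
  proof (rule cring.cring_fieldI2[OF Q.is_cring])
    show "\<zero>\<^bsub>Qp p\<^esub> \<noteq> \<one>\<^bsub>Qp p\<^esub>" using nz by simp
    fix x assume "x \<in> carrier (Qp p)" and x0: "x \<noteq> \<zero>\<^bsub>Qp p\<^esub>"
    have "\<exists>X\<in>carrier ?R. x = pnull p +>\<^bsub>?R\<^esub> X" using \<open>x \<in> carrier (Qp p)\<close>
      unfolding Qp_def FactRing_def A_RCOSETS_def' partial_object.simps UN_iff singleton_iff .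
    then obtain X where X: "pCauchy p X" and x: "x = pnull p +>\<^bsub>?R\<^esub> X" by (rule bexE) simp
    have Xn: "X \<notin> pnull p" using x0 x I.a_rcos_const zero by auto
    obtain k where "\<forall>Z\<in>pnull p. \<forall>\<^sub>F n in sequentially. Z n + X n \<noteq> 0 \<and> rat_val p (Z n + X n) = k"
      using val_const[OF p X Xn] by blast
    from bspec[OF this, of "\<lambda>n. 0"] have ev: "\<forall>\<^sub>F n in sequentially. X n \<noteq> 0 \<and> rat_val p (X n) = k" by (simp add: pnull_def)
    define a where "a = real p powi (- k)"
    have a: "a > 0" using prime_gt_0_nat[OF p] by (simp add: a_def)
    obtain M where M0: "\<forall>n\<ge>M. X n \<noteq> 0 \<and> rat_val p (X n) = k"
      using ev unfolding eventually_sequentially by (rule exE)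
    have M: "X n \<noteq> 0 \<and> rat_pabs p (X n) = a" if "n \<ge> M" for n
      using M0 that by (simp add: rat_pabs_def a_def)
    define Y where "Y n = inverse (X n)" for n
    have "pCauchy p Y" unfolding pCauchy_def
    proof (intro allI impI)
      fix e :: real assume e: "e > 0"
      then obtain N where N: "\<forall>m\<ge>N. \<forall>n\<ge>N. rat_pabs p (X m - X n) < e * (a * a)"
        using pCauchyD[OF X, of "e * (a * a)"] a by auto
      show "\<exists>N. \<forall>m\<ge>N. \<forall>n\<ge>N. rat_pabs p (Y m - Y n) < e"
      proof (intro exI[of _ "max N M"] allI impI)
        fix m n assume mn: "m \<ge> max N M" "n \<ge> max N M"
        then have "X m \<noteq> 0" "X n \<noteq> 0" and ab: "rat_pabs p (X m) = a" "rat_pabs p (X n) = a" using M by auto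
        then have "X n - X m = (Y m - Y n) * (X m * X n)" by (simp add: Y_def field_simps)
        then have "rat_pabs p (X n - X m) = rat_pabs p (Y m - Y n) * (a * a)" by (simp add: pabs_mult[OF p] ab)
        moreover have "rat_pabs p (X n - X m) < e * (a * a)" using N mn by auto
        ultimately show "rat_pabs p (Y m - Y n) < e" using a by simp
      qed
    qed
    then have Y: "Y \<in> carrier ?R" by simp
    have "(\<lambda>n. 1 - X n * Y n) \<in> pnull p" unfolding pnull_def mem_Collect_eq
      by (rule tendsto_eventually, rule eventually_sequentiallyI[of M]) (use M in \<open>simp add: Y_def\<close>)
    then have N1: "(\<lambda>n. 1) \<in> pnull p +>\<^bsub>?R\<^esub> (\<lambda>n. X n * Y n)"
      unfolding pnull_rcos[OF p] mem_Collect_eq by (intro exI[of _ "\<lambda>n. 1 - X n * Y n"]) simp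
    have XY: "x \<otimes>\<^bsub>Qp p\<^esub> (pnull p +>\<^bsub>?R\<^esub> Y) = pnull p +>\<^bsub>?R\<^esub> (\<lambda>n. X n * Y n)"
      using I.rcoset_mult_add[of X Y] X Y by (simp add: Qp_def FactRing_def x)
    have "pnull p +>\<^bsub>?R\<^esub> (\<lambda>n. X n * Y n) = \<one>\<^bsub>Qp p\<^esub>" unfolding one
      by (rule I.a_repr_independence'[OF N1]) (use pCauchy_mult[OF p X \<open>pCauchy p Y\<close>] in simp)
    moreover have "pnull p +>\<^bsub>?R\<^esub> Y \<in> carrier (Qp p)" using Y by (auto simp: Qp_def FactRing_def A_RCOSETS_def')
    ultimately show "\<exists>b\<in>carrier (Qp p). x \<otimes>\<^bsub>Qp p\<^esub> b = \<one>\<^bsub>Qp p\<^esub>" using XY by (intro bexI[of _ "pnull p +>\<^bsub>?R\<^esub> Y"]) simp_all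
  qed
qed

end

theory Submission
  imports Defs "HOL-Computational_Algebra.Squarefree" "HOL-Analysis.Ball_Volume"
begin

text \<open>
  If the conic has a rational point, it has a \<open>p\<close>-adic point for every \<open>p\<close>, so no primed symbol
  is \<open>-1\<close> and no factor vanishes. The substance is the converse: if no primed symbol is \<open>-1\<close>, there
  is a rational point. In particular the existence of a real point has to follow from the conditions at
  the primes.

  The usual route is Hasse-Minkowski together with the product formula, which supplies the real
  condition. A volume argument gives both at once. After removing square factors and the
  gcd of the coefficients, the equation becomes \<open>F = A x^2 + B y^2 + C z^2 = 0\<close> with \<open>A * B * C\<close>
  squarefree. A local solution modulo a small power of \<open>p\<close>, for the primes \<open>p\<close> dividing
  \<open>2 * A * B * C\<close>, yields congruences of index \<open>p\<close> (index 4 or 8 for \<open>p = 2\<close>) that force the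
  corresponding power of \<open>p\<close> to divide \<open>F\<close>; together they have index \<open>4 * \<bar>A * B * C\<bar>\<close> and force
  \<open>4 * \<bar>A * B * C\<bar>\<close> to divide \<open>F\<close>. The ellipsoid
  \<open>\<bar>A\<bar> x^2 + \<bar>B\<bar> y^2 + \<bar>C\<bar> z^2 < 4 * \<bar>A * B * C\<bar>\<close> is large enough for Minkowski's argument, by the
  margin \<open>4 * pi / 3 > 4\<close>, so it contains a nonzero vector satisfying the congruences. There \<open>F\<close> is
  divisible by \<open>4 * \<bar>A * B * C\<bar>\<close> and smaller than it in absolute value, hence \<open>F = 0\<close>. The signs of
  the coefficients never enter; in particular a definite form cannot satisfy all the congruence
  conditions. The two halves of this argument are \<open>coloured_points_in_ellipsoid\<close> and
  \<open>legendre_without_sign_condition\<close>.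

  It remains to see that the primed symbols control exactly these congruences. A prime \<open>p\<close> divides
  \<open>A * B * C\<close> only if one of the valuations of \<open>t1\<close>, \<open>t2\<close> is odd; then the primed symbol is the
  Hilbert symbol, and a \<open>p\<close>-adic point, being a class of Cauchy sequences of rationals, is approximated
  by primitive integer solutions modulo every power of \<open>p\<close>. At \<open>p = 2\<close> with both valuations even,
  either the Hilbert symbol is \<open>1\<close> and the same applies, or the unit parts differ modulo 4; then one of
  them is 1 modulo 4, which is the required 2-adic condition.
\<close>

section \<open>Blichfeldt's principle with colours\<close>

text \<open>
  Cut \<open>S\<close> along the grid of boxes with side lengths \<open>a\<close> and translate all pieces into one box. As \<open>S\<close>
  has more than \<open>m\<close> times the volume of the box, the pieces of some colour have more volume than the
  box, so two of them overlap after the translation. A colouring of the grid points takes the place of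
  the cosets of a sublattice of index \<open>m\<close>, so that no lattice index has to be computed; the stretched
  grid makes it possible to take a ball for \<open>S\<close> where an ellipsoid is meant.
\<close>

lemma blichfeldt_coloured:
  fixes S :: "(real^'n) set" and a :: "real^'n" and col :: "('n \<Rightarrow> int) \<Rightarrow> nat"
  assumes S: "S \<in> lmeasurable" "bounded S"
    and a: "\<And>i. a $ i > 0"
    and col: "\<And>v. col v < m"
    and big: "real m * (\<Prod>i\<in>UNIV. a $ i) < measure lebesgue S"
  obtains v w s t where "v \<noteq> w" "col v = col w" "s \<in> S" "t \<in> S"
    "s - t = (\<chi> i. a $ i * of_int (v i - w i))"
proof -
  define fl where "fl s = (\<lambda>i. \<lfloor>s $ i / a $ i\<rfloor>)" for s
  define corner where "corner v = (\<chi> i. a $ i * of_int (v i))" for v :: "'n \<Rightarrow> int"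
  \<comment> \<open>\<open>P v\<close> is the part of \<open>S\<close> in the box at \<open>v\<close>, written with inequalities to make it visibly Borel.\<close>
  define P where "P v = S \<inter> {s. \<forall>i\<in>UNIV. of_int (v i) \<le> s $ i / a $ i \<and> s $ i / a $ i < of_int (v i) + 1}" for v
  define T where "T v = (+) (- corner v) ` P v" for v
  have P_iff: "s \<in> P v \<longleftrightarrow> s \<in> S \<and> fl s = v" for s v
    by (auto simp: P_def fl_def fun_eq_iff floor_eq_iff)
  obtain R where R: "\<And>s. s \<in> S \<Longrightarrow> norm s \<le> R"
    using S(2) by (auto simp: bounded_iff)
  have finV: "finite (fl ` S)"
  proof (rule finite_subset)
    show "fl ` S \<subseteq> (\<Pi>\<^sub>E i\<in>UNIV. {\<lfloor>- R / a $ i\<rfloor>..\<lfloor>R / a $ i\<rfloor>})"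
    proof clarify
      fix s assume "s \<in> S"
      then have "\<bar>s $ i\<bar> \<le> R" for i
        using R component_le_norm_cart order_trans by blast
      then have "- R / a $ i \<le> s $ i / a $ i \<and> s $ i / a $ i \<le> R / a $ i" for i
        using a[of i] by (intro conjI divide_right_mono) (auto simp: abs_le_iff dest: spec[of _ i], smt (verit))
      then show "fl s \<in> (\<Pi>\<^sub>E i\<in>UNIV. {\<lfloor>- R / a $ i\<rfloor>..\<lfloor>R / a $ i\<rfloor>})"
        unfolding fl_def PiE_UNIV_domain by (auto intro!: floor_mono)
    qed
  qed (auto intro!: finite_PiE)
  have Pm: "P v \<in> lmeasurable" for v
  proof -
    have "{s::real^'n. \<forall>i\<in>UNIV. of_int (v i) \<le> s $ i / a $ i \<and> s $ i / a $ i < of_int (v i) + 1} \<in> sets borel"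
      by measurable
    then have "{s::real^'n. \<forall>i\<in>UNIV. of_int (v i) \<le> s $ i / a $ i \<and> s $ i / a $ i < of_int (v i) + 1} \<in> sets lebesgue"
      by simp
    then show ?thesis unfolding P_def using S(1) by (rule fmeasurable_Int_fmeasurable[rotated])
  qed
  have Tm: "T v \<in> lmeasurable" "measure lebesgue (T v) = measure lebesgue (P v)" for v
    unfolding T_def using measurable_translation[OF Pm] measure_translation by blast+
  have T_box: "T v \<subseteq> cbox 0 a" for v
  proof
    fix x assume "x \<in> T v"
    then obtain s where s: "s \<in> P v" "x = s - corner v" by (auto simp: T_def)
    have "0 \<le> x $ i \<and> x $ i \<le> a $ i" for i
      using s a[of i] unfolding P_def by (auto simp: corner_def field_simps dest!: spec[of _ i])
    then show "x \<in> cbox 0 a" by (simp add: mem_box_cart)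
  qed
  have "\<exists>v w. v \<noteq> w \<and> col v = col w \<and> T v \<inter> T w \<noteq> {}"
  proof (rule ccontr)
    assume "\<not> ?thesis"
    then have disj: "T v \<inter> T w = {}" if "v \<noteq> w" "col v = col w" for v w using that by blast
    have "measure lebesgue S = measure lebesgue (\<Union>v\<in>fl ` S. P v)"
      by (rule arg_cong[where f = "measure lebesgue"]) (auto simp: P_iff)
    also have "\<dots> = (\<Sum>v\<in>fl ` S. measure lebesgue (P v))"
      by (intro measure_UNION' finV Pm) (auto simp: pairwise_def disjnt_def P_iff)
    also have "\<dots> = (\<Sum>c<m. \<Sum>v\<in>{v \<in> fl ` S. col v = c}. measure lebesgue (P v))"
      by (intro sum.group[symmetric] finV) (auto simp: col)
    also have "\<dots> \<le> (\<Sum>c<m. (\<Prod>i\<in>UNIV. a $ i))"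
    proof (rule sum_mono)
      fix c
      let ?V = "{v \<in> fl ` S. col v = c}"
      have "(\<Sum>v\<in>?V. measure lebesgue (P v)) = measure lebesgue (\<Union>v\<in>?V. T v)"
        unfolding Tm(2)[symmetric]
        by (intro measure_UNION'[symmetric] Tm finite_subset[OF _ finV])
           (auto simp: pairwise_def disjnt_def disj)
      also have "\<dots> \<le> measure lebesgue (cbox 0 a)"
        using T_box finV by (intro measure_mono_fmeasurable) (auto intro!: sets.finite_UN fmeasurableD Tm)
      also have "\<dots> = (\<Prod>i\<in>UNIV. a $ i)"
        using order.asym[OF a] by (auto simp: content_cbox_if_cart interval_eq_empty_cart)
      finally show "(\<Sum>v\<in>?V. measure lebesgue (P v)) \<le> (\<Prod>i\<in>UNIV. a $ i)" .
    qed
    finally show False using big by simp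
  qed
  then obtain v w x where vw: "v \<noteq> w" "col v = col w" "x \<in> T v" "x \<in> T w" by blast
  then obtain s t where st: "s \<in> P v" "x = s - corner v" "t \<in> P w" "x = t - corner w"
    by (auto simp: T_def)
  then have "s - t = corner v - corner w" by (simp add: algebra_simps)
  also have "\<dots> = (\<chi> i. a $ i * of_int (v i - w i))"
    by (simp add: corner_def vec_eq_iff algebra_simps)
  finally show ?thesis using that vw st by (auto simp: P_iff)
qed

text \<open>
  With grid side lengths \<open>sqrt A\<close>, \<open>sqrt B\<close>, \<open>sqrt C\<close> a box has volume \<open>r = sqrt (A * B * C)\<close>, and the
  ball of radius \<open>r\<close> has volume \<open>(4 / 3) * pi * r^3 > 4 * A * B * C * r\<close>: more than the number of colours
  times the box. Two of its points differ by less than \<open>2 * r\<close> in norm.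
\<close>

lemma coloured_points_in_ellipsoid:
  fixes A B C :: int and col :: "int \<Rightarrow> int \<Rightarrow> int \<Rightarrow> nat"
  assumes pos: "A > 0" "B > 0" "C > 0"
    and col: "\<And>x y z. col x y z < nat (4 * A * B * C)"
  obtains x y z x' y' z' where "(x, y, z) \<noteq> (x', y', z')" "col x y z = col x' y' z'"
    "A * (x - x')\<^sup>2 + B * (y - y')\<^sup>2 + C * (z - z')\<^sup>2 < 4 * A * B * C"
proof -
  define a :: "real^3" where "a = vector [sqrt A, sqrt B, sqrt C]"
  define r where "r = sqrt (A * B * C)"
  have r: "r > 0" "r\<^sup>2 = of_int (A * B * C)" using pos unfolding r_def by (simp_all only: real_sqrt_gt_0_iff of_int_0_less_iff mult_pos_pos real_sqrt_pow2 of_int_mult less_imp_le mult_nonneg_nonneg of_int_0_le_iff)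
  have a_pos: "a $ i > 0" for i
    using pos exhaust_3[of i] by (auto simp: a_def vector_3)
  have prod_a: "(\<Prod>i\<in>UNIV. a $ i) = r"
    unfolding UNIV_3 a_def r_def by (simp add: vector_3 real_sqrt_mult)
  have "real (nat (4 * A * B * C)) = of_int (4 * A * B * C)"
    using pos by (intro of_nat_nat) simp
  also have "\<dots> = 4 * r\<^sup>2" by (simp add: r(2) mult.assoc)
  finally have "real (nat (4 * A * B * C)) * r = 4 * r ^ 3"
    by (simp add: power2_eq_square power3_eq_cube)
  also have "\<dots> < 4 / 3 * r ^ 3 * pi"
  proof -
    have "r ^ 3 * 3 < r ^ 3 * pi" using pi_gt3 r(1) by (intro mult_strict_left_mono) auto
    then show ?thesis by linarith
  qed
  also have "\<dots> = measure lebesgue (ball (0::real^3) r)"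
    using r by (simp add: sphere_volume)
  finally have big: "real (nat (4 * A * B * C)) * (\<Prod>i\<in>UNIV. a $ i) < measure lebesgue (ball (0::real^3) r)"
    by (simp only: prod_a)
  obtain v w s t where vw: "v \<noteq> w" "col (v 1) (v 2) (v 3) = col (w 1) (w 2) (w 3)"
    and st: "s \<in> ball (0::real^3) r" "t \<in> ball (0::real^3) r"
      "s - t = (\<chi> i. a $ i * of_int (v i - w i))"
    by (rule blichfeldt_coloured[where col = "\<lambda>v. col (v 1) (v 2) (v 3)",
          OF lmeasurable_ball bounded_ball a_pos col big])
  have "norm (s - t) \<le> norm s + norm t" by (rule norm_triangle_ineq4)
  also have "\<dots> < 2 * r" using st(1,2) by simp
  finally have "(norm (s - t))\<^sup>2 < (2 * r)\<^sup>2"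
    by (intro power_strict_mono) auto
  also have "(norm (s - t))\<^sup>2 = (\<Sum>i\<in>UNIV. (a $ i)\<^sup>2 * (of_int (v i - w i))\<^sup>2)"
    unfolding st(3) norm_vec_def L2_set_def by (simp add: sum_nonneg power_mult_distrib)
  also have "\<dots> = of_int (A * (v 1 - w 1)\<^sup>2 + B * (v 2 - w 2)\<^sup>2 + C * (v 3 - w 3)\<^sup>2)"
    using pos unfolding sum_3 a_def vector_3 by simp
  also have "(2 * r)\<^sup>2 = of_int (4 * A * B * C)"
    by (simp add: power_mult_distrib r(2))
  finally have "A * (v 1 - w 1)\<^sup>2 + B * (v 2 - w 2)\<^sup>2 + C * (v 3 - w 3)\<^sup>2 < 4 * A * B * C"
    by (simp only: of_int_less_iff)
  moreover have "(v 1, v 2, v 3) \<noteq> (w 1, w 2, w 3)"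
    using vw(1) by (auto simp: fun_eq_iff forall_3)
  ultimately show ?thesis using that vw(2) by blast
qed

section \<open>Colourings on which a ternary form is divisible\<close>

text \<open>
  The colours play the role of the cosets of a sublattice of index \<open>q\<close> on which \<open>q\<close> divides the form.
\<close>

definition colourable :: "int \<Rightarrow> int \<Rightarrow> int \<Rightarrow> nat \<Rightarrow> bool" where
  "colourable A B C q \<longleftrightarrow> (\<exists>col::int \<Rightarrow> int \<Rightarrow> int \<Rightarrow> nat. (\<forall>x y z. col x y z < q) \<and>
     (\<forall>x y z x' y' z'. col x y z = col x' y' z' \<longrightarrow>
        int q dvd A * (x - x')\<^sup>2 + B * (y - y')\<^sup>2 + C * (z - z')\<^sup>2))"

lemma colourable_rotate: "colourable A B C q \<Longrightarrow> colourable B C A q"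
  unfolding colourable_def
proof (elim exE conjE)
  fix col :: "int \<Rightarrow> int \<Rightarrow> int \<Rightarrow> nat"
  assume "\<forall>x y z. col x y z < q" "\<forall>x y z x' y' z'. col x y z = col x' y' z' \<longrightarrow>
        int q dvd A * (x - x')\<^sup>2 + B * (y - y')\<^sup>2 + C * (z - z')\<^sup>2"
  then show "\<exists>col. (\<forall>x y z. col x y z < q) \<and> (\<forall>x y z x' y' z'. col x y z = col x' y' z' \<longrightarrow>
        int q dvd B * (x - x')\<^sup>2 + C * (y - y')\<^sup>2 + A * (z - z')\<^sup>2)"
    by (intro exI[of _ "\<lambda>x y z. col z x y"]) (auto simp: algebra_simps)
qed

lemma colourable_pair:
  fixes c c' :: "int \<Rightarrow> int \<Rightarrow> int \<Rightarrow> nat"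
  assumes c: "\<And>x y z. c x y z < m" and c': "\<And>x y z. c' x y z < m'"
    and dvd: "\<And>x y z x' y' z'. c x y z = c x' y' z' \<Longrightarrow> c' x y z = c' x' y' z' \<Longrightarrow>
        int (m * m') dvd A * (x - x')\<^sup>2 + B * (y - y')\<^sup>2 + C * (z - z')\<^sup>2"
  shows "colourable A B C (m * m')"
proof -
  define d where "d x y z = c x y z + m * c' x y z" for x y z
  have "d x y z < m * m'" for x y z
  proof -
    have "d x y z < m * Suc (c' x y z)" using c[of x y z] by (simp add: d_def)
    also have "\<dots> \<le> m * m'" using c'[of x y z] by (intro mult_le_mono2) simp
    finally show ?thesis .
  qed
  moreover have "int (m * m') dvd A * (x - x')\<^sup>2 + B * (y - y')\<^sup>2 + C * (z - z')\<^sup>2"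
    if eq: "d x y z = d x' y' z'" for x y z x' y' z'
  proof -
    have "d x y z mod m = c x y z" "d x y z div m = c' x y z" for x y z
      using c[of x y z] by (simp_all add: d_def)
    then have "c x y z = c x' y' z'" "c' x y z = c' x' y' z'" by (metis eq)+
    then show ?thesis by (rule dvd)
  qed
  ultimately show ?thesis unfolding colourable_def by blast
qed

lemma colourable_mult:
  assumes "colourable A B C q" "colourable A B C q'" "coprime q q'"
  shows "colourable A B C (q * q')"
proof -
  obtain c c' :: "int \<Rightarrow> int \<Rightarrow> int \<Rightarrow> nat"
    where c: "\<And>x y z. c x y z < q" "\<And>x y z x' y' z'. c x y z = c x' y' z' \<Longrightarrow>
        int q dvd A * (x - x')\<^sup>2 + B * (y - y')\<^sup>2 + C * (z - z')\<^sup>2"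
      and c': "\<And>x y z. c' x y z < q'" "\<And>x y z x' y' z'. c' x y z = c' x' y' z' \<Longrightarrow>
        int q' dvd A * (x - x')\<^sup>2 + B * (y - y')\<^sup>2 + C * (z - z')\<^sup>2"
    using assms(1,2) unfolding colourable_def by blast
  show ?thesis
    by (rule colourable_pair[of c q c' q', OF c(1) c'(1)])
       (use c(2) c'(2) assms(3) in \<open>simp add: divides_mult\<close>)
qed

text \<open>
  All the congruence conditions needed below are given by at most two linear forms.
\<close>

lemma colourable_linear:
  fixes a b c a' b' c' :: int and m m' :: nat
  assumes "m > 0" "m' > 0"
    and "\<And>x y z. int m dvd a * x + b * y + c * z \<Longrightarrow> int m' dvd a' * x + b' * y + c' * z \<Longrightarrow>
           int (m * m') dvd A * x\<^sup>2 + B * y\<^sup>2 + C * z\<^sup>2"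
  shows "colourable A B C (m * m')"
proof -
  define r where "r x y z = nat ((a * x + b * y + c * z) mod int m)" for x y z
  define r' where "r' x y z = nat ((a' * x + b' * y + c' * z) mod int m')" for x y z
  show ?thesis
  proof (rule colourable_pair[of r m r' m'])
    show "r x y z < m" "r' x y z < m'" for x y z
      using assms(1,2) by (simp_all add: r_def r'_def nat_less_iff)
    fix x y z x' y' z'
    assume "r x y z = r x' y' z'" "r' x y z = r' x' y' z'"
    then have "(a * x + b * y + c * z) mod int m = (a * x' + b * y' + c * z') mod int m"
      "(a' * x + b' * y + c' * z) mod int m' = (a' * x' + b' * y' + c' * z') mod int m'"
      using assms(1,2) by (simp_all add: r_def r'_def eq_nat_nat_iff)
    then have "int m dvd (a * x + b * y + c * z) - (a * x' + b * y' + c * z')"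
      "int m' dvd (a' * x + b' * y + c' * z) - (a' * x' + b' * y' + c' * z')"
      by (simp_all add: mod_eq_dvd_iff)
    then show "int (m * m') dvd A * (x - x')\<^sup>2 + B * (y - y')\<^sup>2 + C * (z - z')\<^sup>2"
      by (intro assms(3)) (simp_all add: algebra_simps)
  qed
qed

text \<open>
  The difference of two points of one colour in the ellipsoid gives a value of the form that is divisible
  by \<open>4 * \<bar>A * B * C\<bar>\<close> and smaller than that in absolute value.
\<close>

lemma colourable_imp_zero:
  assumes nz: "A \<noteq> 0" "B \<noteq> 0" "C \<noteq> 0" and col: "colourable A B C (nat (4 * \<bar>A * B * C\<bar>))"
  obtains x y z :: int where "(x, y, z) \<noteq> (0, 0, 0)" "A * x\<^sup>2 + B * y\<^sup>2 + C * z\<^sup>2 = 0"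
proof -
  obtain c :: "int \<Rightarrow> int \<Rightarrow> int \<Rightarrow> nat"
    where c: "\<And>x y z. c x y z < nat (4 * \<bar>A * B * C\<bar>)" "\<And>x y z x' y' z'. c x y z = c x' y' z' \<Longrightarrow>
        4 * \<bar>A * B * C\<bar> dvd A * (x - x')\<^sup>2 + B * (y - y')\<^sup>2 + C * (z - z')\<^sup>2"
    using col unfolding colourable_def by (auto simp del: abs_mult)
  obtain x y z x' y' z' where v: "(x, y, z) \<noteq> (x', y', z')" "c x y z = c x' y' z'"
    "\<bar>A\<bar> * (x - x')\<^sup>2 + \<bar>B\<bar> * (y - y')\<^sup>2 + \<bar>C\<bar> * (z - z')\<^sup>2 < 4 * \<bar>A\<bar> * \<bar>B\<bar> * \<bar>C\<bar>"
  proof (rule coloured_points_in_ellipsoid[of "\<bar>A\<bar>" "\<bar>B\<bar>" "\<bar>C\<bar>" c])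
    show "c x y z < nat (4 * \<bar>A\<bar> * \<bar>B\<bar> * \<bar>C\<bar>)" for x y z
      using c(1)[of x y z] by (simp add: abs_mult mult.assoc)
  qed (use nz in auto)
  let ?F = "A * (x - x')\<^sup>2 + B * (y - y')\<^sup>2 + C * (z - z')\<^sup>2"
  have "\<bar>?F\<bar> \<le> \<bar>A * (x - x')\<^sup>2\<bar> + \<bar>B * (y - y')\<^sup>2\<bar> + \<bar>C * (z - z')\<^sup>2\<bar>" by linarith
  also have "\<dots> < 4 * \<bar>A * B * C\<bar>" using v(3) by (simp add: abs_mult mult.assoc)
  finally have "\<bar>?F\<bar> < 4 * \<bar>A * B * C\<bar>" .
  with c(2)[OF v(2)] have "?F = 0"
    using dvd_imp_le_int[of ?F "4 * \<bar>A * B * C\<bar>"] by fastforce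
  then show ?thesis using that[of "x - x'" "y - y'" "z - z'"] v(1) by auto
qed

section \<open>Congruence conditions from local solutions\<close>

definition primitive_zero_mod :: "nat \<Rightarrow> nat \<Rightarrow> int \<Rightarrow> int \<Rightarrow> int \<Rightarrow> bool" where
  "primitive_zero_mod p k A B C \<longleftrightarrow> (\<exists>x y z. \<not> (int p dvd x \<and> int p dvd y \<and> int p dvd z) \<and>
     int p ^ k dvd A * x\<^sup>2 + B * y\<^sup>2 + C * z\<^sup>2)"

lemma primitive_zero_mod_rotate:
  assumes "primitive_zero_mod p k A B C"
  shows "primitive_zero_mod p k B C A"
proof -
  obtain x y z where v: "\<not> (int p dvd x \<and> int p dvd y \<and> int p dvd z)"
    "int p ^ k dvd A * x\<^sup>2 + B * y\<^sup>2 + C * z\<^sup>2"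
    using assms unfolding primitive_zero_mod_def by blast
  have "A * x\<^sup>2 + B * y\<^sup>2 + C * z\<^sup>2 = B * y\<^sup>2 + C * z\<^sup>2 + A * x\<^sup>2" by simp
  with v show ?thesis unfolding primitive_zero_mod_def
    by (intro exI[of _ y] exI[of _ z] exI[of _ x]) auto
qed

text \<open>
  In a primitive solution \<open>(x0, y0, z0)\<close> modulo \<open>p^2\<close>, \<open>p\<close> cannot divide \<open>z0\<close>: it would divide \<open>y0\<close>,
  then \<open>p^2\<close> would divide \<open>A * x0^2\<close>, and so \<open>p\<close> would divide \<open>x0\<close> as well. Hence \<open>B * y^2 + C * z^2\<close> vanishes modulo \<open>p\<close> on the line
  through \<open>(y0, z0)\<close>, that is for \<open>z0 * y = y0 * z\<close>; the term \<open>A * x^2\<close> vanishes anyway.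
\<close>

lemma colourable_prime:
  assumes p: "prime p" "int p dvd A" "\<not> int p ^ 2 dvd A" "\<not> int p dvd B" "\<not> int p dvd C"
    and loc: "primitive_zero_mod p 2 A B C"
  shows "colourable A B C p"
proof -
  have pp: "prime (int p)" using p by simp
  obtain x0 y0 z0 where v: "\<not> (int p dvd x0 \<and> int p dvd y0 \<and> int p dvd z0)"
    "int p ^ 2 dvd A * x0\<^sup>2 + B * y0\<^sup>2 + C * z0\<^sup>2"
    using loc unfolding primitive_zero_mod_def by blast
  from v(2) have "int p dvd A * x0\<^sup>2 + B * y0\<^sup>2 + C * z0\<^sup>2"
    by (auto intro: dvd_trans[rotated])
  then have F: "int p dvd B * y0\<^sup>2 + C * z0\<^sup>2"
    using p(2) by (metis add.assoc dvd_add_right_iff dvd_mult2)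
  have z0: "\<not> int p dvd z0"
  proof
    assume z: "int p dvd z0"
    then have "int p dvd B * y0\<^sup>2" using F by (simp add: power2_eq_square dvd_add_left_iff)
    then have y: "int p dvd y0"
      using pp p by (simp add: prime_dvd_mult_iff prime_dvd_power_iff)
    have "int p ^ 2 dvd B * y0\<^sup>2 + C * z0\<^sup>2"
      using y z by (intro dvd_add dvd_mult) (simp_all add: dvd_power_same)
    then have "int p ^ 2 dvd A * x0\<^sup>2"
      using v(2) by (metis add.assoc dvd_add_left_iff)
    moreover have x: "\<not> int p dvd x0" using v(1) y z by blast
    then have "coprime (int p ^ 2) (x0\<^sup>2)"
      using pp by (simp add: prime_imp_coprime)
    ultimately have "int p ^ 2 dvd A" by (simp add: coprime_dvd_mult_left_iff)
    then show False using p by blast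
  qed
  have "colourable A B C (p * 1)"
  proof (rule colourable_linear[of p 1 0 z0 "- y0" 0 0 0 A B C])
    fix x y z :: int
    assume "int p dvd 0 * x + z0 * y + - y0 * z"
    then have "int p dvd B * (z0 * y + y0 * z) * (z0 * y - y0 * z)" by simp
    moreover have "int p dvd z\<^sup>2 * (B * y0\<^sup>2 + C * z0\<^sup>2)" using F by simp
    ultimately have "int p dvd B * (z0 * y + y0 * z) * (z0 * y - y0 * z) + z\<^sup>2 * (B * y0\<^sup>2 + C * z0\<^sup>2)"
      by (rule dvd_add)
    also have "\<dots> = z0\<^sup>2 * (B * y\<^sup>2 + C * z\<^sup>2)"
      by (simp add: algebra_simps power2_eq_square)
    finally have "int p dvd B * y\<^sup>2 + C * z\<^sup>2"
      using z0 pp by (simp add: prime_dvd_mult_iff prime_dvd_power_iff)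
    then show "int (p * 1) dvd A * x\<^sup>2 + B * y\<^sup>2 + C * z\<^sup>2"
      using p(2) by (simp add: add.assoc)
  qed (use p prime_gt_0_nat in auto)
  then show ?thesis by simp
qed

lemma odd_square_mod_8: "odd (x::int) \<Longrightarrow> \<exists>k. x\<^sup>2 = 8 * k + 1"
proof -
  assume "odd x"
  then obtain j where j: "x = 2 * j + 1" by (rule oddE)
  have "even (j * (j + 1))" by simp
  then obtain k where "j * (j + 1) = 2 * k" by (rule evenE)
  then have "x\<^sup>2 = 8 * k + 1" by (simp add: j power2_eq_square algebra_simps)
  then show ?thesis ..
qed

text \<open>
  The congruences are \<open>z = 0\<close> and \<open>x = y\<close> modulo 2: then \<open>x^2 = y^2\<close> modulo 4.
\<close>

lemma colourable_4:
  assumes "4 dvd A + B"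
  shows "colourable A B C 4"
proof -
  have "colourable A B C (2 * 2)"
  proof (rule colourable_linear[of 2 2 0 0 1 1 1 0 A B C])
    fix x y z :: int
    assume "int 2 dvd 0 * x + 0 * y + 1 * z" "int 2 dvd 1 * x + 1 * y + 0 * z"
    then have "2 dvd z" "2 dvd x + y" by simp_all
    then obtain k l where kl: "z = 2 * k" "x + y = 2 * l" unfolding dvd_def by blast
    then have x: "x = 2 * l - y" by simp
    obtain j where j: "A = 4 * j - B" using assms by (metis add_diff_cancel_right' dvdE)
    have "A * x\<^sup>2 + B * y\<^sup>2 + C * z\<^sup>2 = 4 * (A * l * (l - y) + j * y\<^sup>2 + C * k\<^sup>2)"
      by (simp add: kl(1) x j power2_eq_square algebra_simps)
    then show "int (2 * 2) dvd A * x\<^sup>2 + B * y\<^sup>2 + C * z\<^sup>2" by simp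
  qed simp_all
  then show ?thesis by simp
qed

text \<open>
  The congruences are \<open>y + z = 0\<close> modulo 4, whence \<open>y^2 = z^2\<close> modulo 8, and modulo 2 either \<open>x = 0\<close> or
  \<open>x = y\<close>, according to which of the two sums is divisible by 8. The number \<open>e\<close> in the proof, 0 or 1,
  treats both cases at once.
\<close>

lemma colourable_8:
  assumes A: "even A" and BC: "8 dvd B + C \<or> 8 dvd A + B + C"
  shows "colourable A B C 8"
proof -
  from BC obtain e where e: "e = 0 \<or> e = 1" "8 dvd e * A + B + C" by (metis mult_1 mult_zero_left add_0)
  have "colourable A B C (2 * 4)"
  proof (rule colourable_linear[of 2 4 1 e 0 0 1 1 A B C])
    fix x y z :: int
    assume "int 2 dvd 1 * x + e * y + 0 * z" "int 4 dvd 0 * x + 1 * y + 1 * z"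
    then have "2 dvd x + e * y" "4 dvd y + z" by simp_all
    then obtain k l where kl: "x + e * y = 2 * k" "y + z = 4 * l" unfolding dvd_def by blast
    then have xz: "x = 2 * k - e * y" "z = 4 * l - y" by simp_all
    obtain j where j: "C = 8 * j - e * A - B"
      using e(2) by (elim dvdE) (simp add: algebra_simps)
    obtain A' where A': "A = 2 * A'" using A by (rule evenE)
    have ee: "e * e = e" using e(1) by auto
    have "A * x\<^sup>2 + B * y\<^sup>2 + C * z\<^sup>2
        = A * (4 * k\<^sup>2 - 4 * k * e * y + (e * e - e) * y\<^sup>2) + (e * A + B + C) * y\<^sup>2 + C * (16 * l\<^sup>2 - 8 * l * y)"
      by (simp add: xz power2_eq_square algebra_simps)
    also have "\<dots> = 8 * (A' * (k\<^sup>2 - k * e * y) + j * y\<^sup>2 + C * (2 * l\<^sup>2 - l * y))"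
      by (simp add: ee j A' algebra_simps)
    finally show "int (2 * 4) dvd A * x\<^sup>2 + B * y\<^sup>2 + C * z\<^sup>2" by simp
  qed simp_all
  then show ?thesis by simp
qed

text \<open>
  Squares modulo 4 are 0 and 1. By parity exactly two of the three variables are odd in a primitive
  solution, and the sum of their coefficients is the value of the form modulo 4.
\<close>

lemma primitive_zero_mod_4:
  assumes "odd A" "odd B" "odd C" "primitive_zero_mod 2 2 A B C"
  shows "4 dvd A + B \<or> 4 dvd B + C \<or> 4 dvd C + A"
proof -
  obtain x y z where v: "\<not> (even x \<and> even y \<and> even z)" "4 dvd A * x\<^sup>2 + B * y\<^sup>2 + C * z\<^sup>2"
    using assms(4) unfolding primitive_zero_mod_def by auto
  have sq: "\<exists>k. t\<^sup>2 = 4 * k + (if odd t then 1 else 0)" for t :: int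
  proof (cases "odd t")
    case True
    then obtain k where "t\<^sup>2 = 8 * k + 1" using odd_square_mod_8 by blast
    then show ?thesis using True by (intro exI[of _ "2 * k"]) simp
  next
    case False
    then obtain k where "t = 2 * k" by blast
    then show ?thesis by (intro exI[of _ "k\<^sup>2"]) (simp add: power2_eq_square)
  qed
  obtain k l m where klm: "x\<^sup>2 = 4 * k + (if odd x then 1 else 0)" "y\<^sup>2 = 4 * l + (if odd y then 1 else 0)"
    "z\<^sup>2 = 4 * m + (if odd z then 1 else 0)"
    using sq by metis
  have "A * x\<^sup>2 + B * y\<^sup>2 + C * z\<^sup>2 = 4 * (A * k + B * l + C * m) +
     ((if odd x then A else 0) + (if odd y then B else 0) + (if odd z then C else 0))"
    by (simp add: klm algebra_simps)
  with v(2) have D: "4 dvd (if odd x then A else 0) + (if odd y then B else 0) + (if odd z then C else 0)"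
    by (metis dvd_add_right_iff dvd_triv_left)
  then have "even ((if odd x then A else 0) + (if odd y then B else 0) + (if odd z then C else 0))"
    by (rule dvd_trans[rotated]) simp
  with D v(1) assms(1-3) show ?thesis by (auto split: if_splits simp: add.commute)
qed

text \<open>
  In a primitive solution \<open>y\<close> and \<open>z\<close> are odd: they have the same parity, and if both are even, then
  \<open>A * x^2\<close> is divisible by 4 and \<open>x\<close> is even too. Odd squares are 1 modulo 8, so the value of the form
  modulo 8 depends on the parity of \<open>x\<close> only.
\<close>

lemma primitive_zero_mod_8:
  assumes A: "even A" "\<not> 4 dvd A" "odd B" "odd C" and loc: "primitive_zero_mod 2 3 A B C"
  shows "8 dvd B + C \<or> 8 dvd A + B + C"
proof -
  obtain x y z where v: "\<not> (even x \<and> even y \<and> even z)" "8 dvd A * x\<^sup>2 + B * y\<^sup>2 + C * z\<^sup>2"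
    using loc unfolding primitive_zero_mod_def by auto
  obtain A' where A': "A = 2 * A'" using A(1) by (rule evenE)
  have "odd A'" using A(2) by (auto simp: A' elim!: evenE)
  have ev: "even (A * x\<^sup>2 + B * y\<^sup>2 + C * z\<^sup>2)"
    by (rule dvd_trans[OF _ v(2)]) simp
  then have yz: "even y \<longleftrightarrow> even z" using A by auto
  have "odd y"
  proof
    assume "even y"
    then obtain y' z' where yz': "y = 2 * y'" "z = 2 * z'" using yz by (auto elim!: evenE)
    have "4 dvd A * x\<^sup>2 + B * y\<^sup>2 + C * z\<^sup>2" by (rule dvd_trans[OF _ v(2)]) simp
    moreover have "A * x\<^sup>2 + B * y\<^sup>2 + C * z\<^sup>2 = 2 * (A' * x\<^sup>2) + 4 * (B * y'\<^sup>2 + C * z'\<^sup>2)"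
      by (simp add: A' yz' power2_eq_square algebra_simps)
    ultimately have "2 * 2 dvd 2 * (A' * x\<^sup>2)"
      by (metis dvd_add_left_iff dvd_triv_left mult_2 numeral_Bit0)
    then have "even (A' * x\<^sup>2)" by (subst (asm) dvd_mult_cancel_left) simp
    with \<open>odd A'\<close> have "even x" by simp
    with v(1) yz \<open>even y\<close> show False by blast
  qed
  then obtain l m where lm: "y\<^sup>2 = 8 * l + 1" "z\<^sup>2 = 8 * m + 1"
    using yz odd_square_mod_8 by metis
  show ?thesis
  proof (cases "even x")
    case True
    then obtain x' where "x = 2 * x'" by (rule evenE)
    then have "A * x\<^sup>2 + B * y\<^sup>2 + C * z\<^sup>2 = 8 * (A' * x'\<^sup>2 + B * l + C * m) + (B + C)"
      unfolding lm A' by (simp add: power2_eq_square algebra_simps)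
    then show ?thesis using v(2) by (metis dvd_add_right_iff dvd_triv_left)
  next
    case False
    then obtain k where "x\<^sup>2 = 8 * k + 1" using odd_square_mod_8 by blast
    then have "A * x\<^sup>2 + B * y\<^sup>2 + C * z\<^sup>2 = 8 * (A * k + B * l + C * m) + (A + B + C)"
      by (simp add: lm algebra_simps)
    then show ?thesis using v(2) by (metis dvd_add_right_iff dvd_triv_left)
  qed
qed

lemma colourable_squarefree:
  assumes "squarefree (n::nat)" "\<And>p. prime p \<Longrightarrow> p dvd n \<Longrightarrow> colourable A B C p"
  shows "colourable A B C n"
proof -
  have "colourable A B C (\<Prod>P)" if "finite P" "\<And>p. p \<in> P \<Longrightarrow> prime p \<and> colourable A B C p" for P
    using that
  proof (induction P rule: finite_induct)
    case empty
    show ?case unfolding colourable_def by (auto intro!: exI[of _ "\<lambda>x y z. 0"])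
  next
    case (insert p P)
    have "coprime p (\<Prod>P)"
      using insert by (intro prod_coprime_right) (metis insertCI primes_coprime)
    then show ?case using insert by (simp add: colourable_mult)
  qed
  from this[of "prime_factors n"] have "colourable A B C (\<Prod>(prime_factors n))"
    using assms(2) by (auto simp: in_prime_factors_iff)
  also have "\<Prod>(prime_factors n) = n"
  proof -
    have n: "n \<noteq> 0" using assms(1) by (metis not_squarefree_0)
    then have "\<forall>p\<in>prime_factors n. multiplicity p n = 1"
      using assms(1) squarefree_factorial_semiring'[OF n] by blast
    then have "\<Prod>(prime_factors n) = (\<Prod>p\<in>prime_factors n. p ^ multiplicity p n)" by simp
    also have "\<dots> = n" using prime_factorization_nat[of n] n by simp
    finally show ?thesis .
  qed
  finally show ?thesis .
qed

text \<open>
  Multiplying the colourings for the primes dividing \<open>A * B * C\<close> and for 2 gives exactly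
  \<open>4 * \<bar>A * B * C\<bar>\<close> colours. If \<open>A * B * C\<close> is even, its own factor 2 is absorbed in the
  8 colours used at 2.
\<close>

lemma legendre_without_sign_condition:
  fixes A B C :: int
  assumes sqf: "squarefree (A * B * C)"
    and loc: "\<And>p k. prime p \<Longrightarrow> int p dvd A * B * C \<Longrightarrow> primitive_zero_mod p k A B C"
    and two: "odd (A * B * C) \<Longrightarrow> 4 dvd A + B \<or> 4 dvd B + C \<or> 4 dvd C + A"
  obtains x y z :: int where "(x, y, z) \<noteq> (0, 0, 0)" "A * x\<^sup>2 + B * y\<^sup>2 + C * z\<^sup>2 = 0"
proof -
  have sq: "\<not> int p ^ 2 dvd A * B * C" if "prime p" for p
    using squarefreeD[OF sqf, of "int p"] that by (auto dest: not_prime_unit)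
  have cases: "(int p dvd A \<and> \<not> int p ^ 2 dvd A \<and> \<not> int p dvd B \<and> \<not> int p dvd C)
     \<or> (int p dvd B \<and> \<not> int p ^ 2 dvd B \<and> \<not> int p dvd C \<and> \<not> int p dvd A)
     \<or> (int p dvd C \<and> \<not> int p ^ 2 dvd C \<and> \<not> int p dvd A \<and> \<not> int p dvd B)"
    if "prime p" "int p dvd A * B * C" for p
  proof -
    have "int p dvd A \<or> int p dvd B \<or> int p dvd C"
      using that by (simp add: prime_dvd_mult_iff)
    moreover have "\<not> (int p dvd A \<and> int p dvd B)" "\<not> (int p dvd A \<and> int p dvd C)"
      "\<not> (int p dvd B \<and> int p dvd C)" "\<not> int p ^ 2 dvd A" "\<not> int p ^ 2 dvd B" "\<not> int p ^ 2 dvd C"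
      using sq[OF that(1)] unfolding power2_eq_square
      by (auto intro: mult_dvd_mono dvd_mult dvd_mult2 simp: mult.assoc mult.left_commute[of A B C])
    ultimately show ?thesis by blast
  qed
  have odd_prime: "colourable A B C p" if "prime p" "int p dvd A * B * C" for p
  proof -
    note c = colourable_prime[OF that(1)]
    have l: "primitive_zero_mod p 2 A B C" "primitive_zero_mod p 2 B C A" "primitive_zero_mod p 2 C A B"
      using loc[OF that] primitive_zero_mod_rotate by blast+
    from cases[OF that] show ?thesis
      using c[OF _ _ _ _ l(1)] c[OF _ _ _ _ l(2), THEN colourable_rotate, THEN colourable_rotate]
        c[OF _ _ _ _ l(3), THEN colourable_rotate] by blast
  qed
  define N where "N = nat \<bar>A * B * C\<bar>"
  have ABC: "A * B * C \<noteq> 0" using sqf by auto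
  have N: "int p dvd A * B * C \<longleftrightarrow> p dvd N" for p
    unfolding N_def by (simp only: dvd_nat_abs_iff)
  have sqN: "squarefree N"
  proof (rule squarefreeI)
    fix x assume "x\<^sup>2 dvd N"
    then have "int x ^ 2 dvd A * B * C" by (simp flip: N)
    then have "int x dvd 1" by (rule squarefreeD[OF sqf])
    then show "x dvd 1" by simp
  qed
  have "colourable A B C (4 * N)"
  proof (cases "odd N")
    case True
    then have "odd (A * B * C)" using N[of 2] by simp
    then have "colourable A B C 4"
      using two colourable_4 colourable_rotate by blast
    moreover have "colourable A B C N"
      using colourable_squarefree[OF sqN] odd_prime N by blast
    moreover have "coprime (2 ^ 2) N" using True by (simp only: coprime_power_left_iff coprime_left_2_iff_odd) simp
    then have "coprime 4 N" by simp
    ultimately show ?thesis by (rule colourable_mult)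
  next
    case False
    then obtain n where n: "N = 2 * n" by blast
    have "odd n" using sqN squarefreeD[OF sqN, of 2] by (auto simp: n elim!: evenE)
    have "colourable A B C 8"
    proof -
      have two: "int 2 dvd A * B * C" using False N[of 2] by simp
      have c: "colourable X Y Z 8" if "even X \<and> \<not> 4 dvd X \<and> odd Y \<and> odd Z" "primitive_zero_mod 2 3 X Y Z"
        for X Y Z
        using colourable_8 primitive_zero_mod_8 that by blast
      have l: "primitive_zero_mod 2 3 A B C" "primitive_zero_mod 2 3 B C A" "primitive_zero_mod 2 3 C A B"
        using loc[OF two_is_prime_nat two] primitive_zero_mod_rotate by blast+
      from cases[OF two_is_prime_nat two] show ?thesis
        using c[OF _ l(1)] c[OF _ l(2), THEN colourable_rotate, THEN colourable_rotate]
          c[OF _ l(3), THEN colourable_rotate] by (elim disjE) auto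
    qed
    moreover have "colourable A B C n"
      using colourable_squarefree[of n] squarefree_mono[OF _ sqN, of n] odd_prime N n by auto
    moreover have "coprime (2 ^ 3) n" using \<open>odd n\<close> by (simp only: coprime_power_left_iff coprime_left_2_iff_odd) simp
    then have "coprime 8 n" by simp
    ultimately have "colourable A B C (8 * n)" by (rule colourable_mult)
    then show ?thesis by (simp add: n)
  qed
  then have "colourable A B C (nat (4 * \<bar>A * B * C\<bar>))" by (simp add: N_def nat_mult_distrib)
  then show ?thesis using colourable_imp_zero[of A B C] ABC that by auto
qed

section \<open>Approximate p-adic zeros and integer solutions of congruences\<close>

lemma rat_val_of_int:
  assumes "prime p" "n \<noteq> 0"
  shows "rat_val p (of_int n) = int (multiplicity (int p) n)"
  using rat_val_eq[OF assms, of 1] by simp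

lemma pabs_divide: "prime p \<Longrightarrow> s \<noteq> 0 \<Longrightarrow> rat_pabs p (x / s) = rat_pabs p x / rat_pabs p s"
  using pabs_mult[of p "x / s" s] pabs_pos[of p s] by (simp add: field_simps)

lemma pabs_of_int:
  assumes p: "prime p" and n: "n \<noteq> 0"
  shows "rat_pabs p (of_int n) = 1 / real p ^ multiplicity (int p) n"
  using n by (simp add: rat_pabs_def rat_val_of_int[OF p n] power_int_minus power_int_of_nat field_simps)

lemma pabs_of_int_eq_1_iff:
  assumes p: "prime p"
  shows "rat_pabs p (of_int n) = 1 \<longleftrightarrow> \<not> int p dvd n"
proof (cases "n = 0")
  case False
  have p1: "real p > 1" using prime_gt_1_nat[OF p] by simp
  have "real p ^ multiplicity (int p) n > 1" if "multiplicity (int p) n \<noteq> 0"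
    using p1 that by (intro one_less_power) auto
  then have "rat_pabs p (of_int n) = 1 \<longleftrightarrow> multiplicity (int p) n = 0"
    unfolding pabs_of_int[OF p False] by (cases "multiplicity (int p) n = 0") auto
  also have "\<dots> \<longleftrightarrow> \<not> int p dvd n"
    using False p by (simp add: prime_elem_multiplicity_eq_zero_iff)
  finally show ?thesis .
qed simp

lemma pabs_of_int_less_imp_dvd:
  assumes p: "prime p" and less: "rat_pabs p (of_int n) < 1 / real p ^ k"
  shows "int p ^ k dvd n"
proof (cases "n = 0")
  case False
  have p1: "real p > 1" using prime_gt_1_nat[OF p] by simp
  have "1 / real p ^ multiplicity (int p) n < 1 / real p ^ k"
    using less by (simp add: pabs_of_int[OF p False])
  then have "real p ^ k < real p ^ multiplicity (int p) n"
    using p1 by (simp add: field_simps)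
  then have "k < multiplicity (int p) n" using p1 by simp
  then show ?thesis by (intro multiplicity_dvd') simp
qed simp

lemma pabs_le_1_fraction:
  assumes p: "prime p" and x: "rat_pabs p x \<le> 1"
  obtains n d :: int where "x = of_int n / of_int d" "\<not> int p dvd d"
proof -
  obtain n d where nd: "quotient_of x = (n, d)" by force
  have d: "d > 0" and cop: "coprime n d" and q: "x = of_int n / of_int d"
    using quotient_of_denom_pos[OF nd] quotient_of_coprime[OF nd] quotient_of_div[OF nd] by auto
  have "\<not> int p dvd d"
  proof
    assume pd: "int p dvd d"
    then have pn: "\<not> int p dvd n"
      using cop p by (metis coprime_common_divisor not_prime_unit prime_nat_int_transfer)
    have "rat_pabs p (of_int d) < 1"
      using pabs_of_int_eq_1_iff[OF p, of d] pd d pabs_of_int[OF p, of d] prime_ge_1_nat[OF p]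
      by (smt (verit) divide_le_eq_1 of_nat_1 of_nat_mono one_le_power)
    moreover have "rat_pabs p (of_int d) > 0" using pabs_pos[OF p] d by simp
    ultimately have "1 < rat_pabs p (of_int n) / rat_pabs p (of_int d)"
      using pabs_of_int_eq_1_iff[OF p, of n] pn by simp
    then show False using x pabs_divide[OF p] d by (simp add: q)
  qed
  with q show ?thesis using that by blast
qed

text \<open>
  Having a nontrivial zero over the \<open>p\<close>-adic numbers, expressed with rational approximations: vectors
  bounded away from 0 on which the form is arbitrarily small. Allowing any lower bound \<open>\<delta>\<close>, rather than
  normalising the vectors, makes the notion invariant under diagonal changes of variables.
\<close>

definition padically_isotropic :: "nat \<Rightarrow> rat \<Rightarrow> rat \<Rightarrow> rat \<Rightarrow> bool" where
  "padically_isotropic p A B C \<longleftrightarrow> (\<exists>\<delta>>0. \<forall>e>0. \<exists>x y z.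
     (\<delta> \<le> rat_pabs p x \<or> \<delta> \<le> rat_pabs p y \<or> \<delta> \<le> rat_pabs p z) \<and>
     rat_pabs p (A * x\<^sup>2 + B * y\<^sup>2 + C * z\<^sup>2) < e)"

lemma padically_isotropic_similar:
  assumes p: "prime p" and iso: "padically_isotropic p (c * A * r\<^sup>2) (c * B * s\<^sup>2) (c * C * t\<^sup>2)"
    and nz: "c \<noteq> 0" "r \<noteq> 0" "s \<noteq> 0" "t \<noteq> 0"
  shows "padically_isotropic p A B C"
proof -
  obtain \<delta> where d: "\<delta> > 0" and sol: "\<And>e. e > 0 \<Longrightarrow> \<exists>x y z.
     (\<delta> \<le> rat_pabs p x \<or> \<delta> \<le> rat_pabs p y \<or> \<delta> \<le> rat_pabs p z) \<and>
     rat_pabs p (c * A * r\<^sup>2 * x\<^sup>2 + c * B * s\<^sup>2 * y\<^sup>2 + c * C * t\<^sup>2 * z\<^sup>2) < e"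
    using iso unfolding padically_isotropic_def by blast
  define m where "m = min (rat_pabs p r) (min (rat_pabs p s) (rat_pabs p t))"
  have m: "m > 0" "m \<le> rat_pabs p r" "m \<le> rat_pabs p s" "m \<le> rat_pabs p t"
    using nz by (auto simp: m_def pabs_pos[OF p])
  have c: "rat_pabs p c > 0" using pabs_pos[OF p nz(1)] .
  show ?thesis unfolding padically_isotropic_def
  proof (intro exI[of _ "m * \<delta>"] conjI allI impI)
    show "m * \<delta> > 0" using m d by simp
    fix e :: real assume e: "e > 0"
    then obtain x y z where v: "\<delta> \<le> rat_pabs p x \<or> \<delta> \<le> rat_pabs p y \<or> \<delta> \<le> rat_pabs p z"
      "rat_pabs p (c * A * r\<^sup>2 * x\<^sup>2 + c * B * s\<^sup>2 * y\<^sup>2 + c * C * t\<^sup>2 * z\<^sup>2) < rat_pabs p c * e"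
      using sol[of "rat_pabs p c * e"] c by auto
    have mul: "m * \<delta> \<le> rat_pabs p (u * w)" if "m \<le> rat_pabs p u" "\<delta> \<le> rat_pabs p w" for u w
      unfolding pabs_mult[OF p] using that d m(1) by (intro mult_mono) auto
    have "c * A * r\<^sup>2 * x\<^sup>2 + c * B * s\<^sup>2 * y\<^sup>2 + c * C * t\<^sup>2 * z\<^sup>2
        = c * (A * (r * x)\<^sup>2 + B * (s * y)\<^sup>2 + C * (t * z)\<^sup>2)"
      by (simp add: power_mult_distrib algebra_simps)
    then have "rat_pabs p (A * (r * x)\<^sup>2 + B * (s * y)\<^sup>2 + C * (t * z)\<^sup>2) < e"
      using v(2) c by (simp add: pabs_mult[OF p])
    moreover have "m * \<delta> \<le> rat_pabs p (r * x) \<or> m * \<delta> \<le> rat_pabs p (s * y) \<or> m * \<delta> \<le> rat_pabs p (t * z)"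
      using v(1) mul m by blast
    ultimately show "\<exists>x y z. (m * \<delta> \<le> rat_pabs p x \<or> m * \<delta> \<le> rat_pabs p y \<or> m * \<delta> \<le> rat_pabs p z) \<and>
       rat_pabs p (A * x\<^sup>2 + B * y\<^sup>2 + C * z\<^sup>2) < e" by blast
  qed
qed

text \<open>
  Dividing a good approximation by its largest coordinate makes all coordinates \<open>p\<close>-integral and one of
  them a unit. Clearing the denominators, which are prime to \<open>p\<close>, then keeps the absolute values.
\<close>

lemma padically_isotropic_imp_primitive_zero_mod:
  assumes p: "prime p" and iso: "padically_isotropic p (of_int A) (of_int B) (of_int C)"
  shows "primitive_zero_mod p k A B C"
proof -
  obtain \<delta> where d: "\<delta> > 0" and sol: "\<And>e. e > 0 \<Longrightarrow> \<exists>x y z.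
     (\<delta> \<le> rat_pabs p x \<or> \<delta> \<le> rat_pabs p y \<or> \<delta> \<le> rat_pabs p z) \<and>
     rat_pabs p (of_int A * x\<^sup>2 + of_int B * y\<^sup>2 + of_int C * z\<^sup>2) < e"
    using iso unfolding padically_isotropic_def by blast
  have pk: "1 / real p ^ k > 0" using prime_gt_0_nat[OF p] by simp
  obtain x y z where v: "\<delta> \<le> rat_pabs p x \<or> \<delta> \<le> rat_pabs p y \<or> \<delta> \<le> rat_pabs p z"
    "rat_pabs p (of_int A * x\<^sup>2 + of_int B * y\<^sup>2 + of_int C * z\<^sup>2) < 1 / real p ^ k * \<delta>\<^sup>2"
    using sol[of "1 / real p ^ k * \<delta>\<^sup>2"] pk d by auto
  obtain s where s: "s \<in> {x, y, z}" "\<delta> \<le> rat_pabs p s"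
    "rat_pabs p x \<le> rat_pabs p s" "rat_pabs p y \<le> rat_pabs p s" "rat_pabs p z \<le> rat_pabs p s"
  proof -
    let ?M = "rat_pabs p ` {x, y, z}"
    have "Max ?M \<in> ?M" by (rule Max_in) auto
    then obtain s where s: "s \<in> {x, y, z}" "Max ?M = rat_pabs p s" by blast
    have "rat_pabs p t \<le> rat_pabs p s" if "t \<in> {x, y, z}" for t
      unfolding s(2)[symmetric] using that by (intro Max_ge) auto
    then have "rat_pabs p x \<le> rat_pabs p s" "rat_pabs p y \<le> rat_pabs p s" "rat_pabs p z \<le> rat_pabs p s"
      by simp_all
    then show ?thesis using that[of s] s(1) v(1) by (meson order_trans)
  qed
  have s0: "rat_pabs p s > 0" "s \<noteq> 0" using s(2) d by auto
  have unit: "rat_pabs p (t / s) \<le> 1" if "rat_pabs p t \<le> rat_pabs p s" for t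
    using that s0 by (simp add: pabs_divide[OF p])
  obtain a a' where a: "x / s = of_int a / of_int a'" "\<not> int p dvd a'"
    using pabs_le_1_fraction[OF p unit[OF s(3)]] .
  obtain b b' where b: "y / s = of_int b / of_int b'" "\<not> int p dvd b'"
    using pabs_le_1_fraction[OF p unit[OF s(4)]] .
  obtain c c' where c: "z / s = of_int c / of_int c'" "\<not> int p dvd c'"
    using pabs_le_1_fraction[OF p unit[OF s(5)]] .
  have nz: "a' \<noteq> 0" "b' \<noteq> 0" "c' \<noteq> 0" using a b c by auto
  define D where "D = a' * b' * c'"
  define X where "X = a * b' * c'"
  define Y where "Y = b * a' * c'"
  define Z where "Z = c * a' * b'"
  have pD: "rat_pabs p (of_int D) = 1"
    using a(2) b(2) c(2) p unfolding pabs_of_int_eq_1_iff[OF p] D_def by (simp add: prime_dvd_mult_iff)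
  have XYZ: "of_int X = of_int D * (x / s)" "of_int Y = of_int D * (y / s)" "of_int Z = of_int D * (z / s)"
    using nz by (simp_all add: a(1) b(1) c(1) X_def Y_def Z_def D_def)
  have "rat_pabs p (of_int X) = 1 \<or> rat_pabs p (of_int Y) = 1 \<or> rat_pabs p (of_int Z) = 1"
    using s(1) s0 unfolding XYZ pabs_mult[OF p] pD by auto
  then have prim: "\<not> (int p dvd X \<and> int p dvd Y \<and> int p dvd Z)"
    by (simp add: pabs_of_int_eq_1_iff[OF p])
  have "of_int (A * X\<^sup>2 + B * Y\<^sup>2 + C * Z\<^sup>2)
      = (of_int D)\<^sup>2 * ((of_int A * x\<^sup>2 + of_int B * y\<^sup>2 + of_int C * z\<^sup>2) / s\<^sup>2)"
    unfolding of_int_add of_int_mult of_int_power XYZ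
    by (simp add: power_mult_distrib power_divide add_divide_distrib algebra_simps)
  then have "rat_pabs p (of_int (A * X\<^sup>2 + B * Y\<^sup>2 + C * Z\<^sup>2))
      = rat_pabs p (of_int A * x\<^sup>2 + of_int B * y\<^sup>2 + of_int C * z\<^sup>2) / (rat_pabs p s)\<^sup>2"
    using s0 pD by (simp add: pabs_mult[OF p] pabs_divide[OF p] power2_eq_square del: of_int_add of_int_mult of_int_power)
  also have "\<dots> < 1 / real p ^ k * \<delta>\<^sup>2 / (rat_pabs p s)\<^sup>2"
    using v(2) s0 by (intro divide_strict_right_mono) auto
  also have "\<dots> \<le> 1 / real p ^ k"
  proof -
    have "\<delta>\<^sup>2 \<le> (rat_pabs p s)\<^sup>2" using s(2) d by (intro power_mono) auto
    then have "\<delta>\<^sup>2 / (rat_pabs p s)\<^sup>2 \<le> 1" using s0 by simp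
    then show ?thesis using mult_left_mono[of _ 1 "1 / real p ^ k"] pk by fastforce
  qed
  finally have "int p ^ k dvd A * X\<^sup>2 + B * Y\<^sup>2 + C * Z\<^sup>2"
    by (rule pabs_of_int_less_imp_dvd[OF p])
  with prim show ?thesis unfolding primitive_zero_mod_def by blast
qed

section \<open>Rational conics over the p-adic numbers\<close>

abbreviation Qp_class :: "nat \<Rightarrow> (nat \<Rightarrow> rat) \<Rightarrow> (nat \<Rightarrow> rat) set" where
  "Qp_class p X \<equiv> pnull p +>\<^bsub>pCauchy_ring p\<^esub> X"

lemma Qp_carrier: "carrier (Qp p) = {Qp_class p X |X. pCauchy p X}"
  by (auto simp: Qp_def FactRing_def A_RCOSETS_def')

lemma Qp_zero: "\<zero>\<^bsub>Qp p\<^esub> = pnull p"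
  by (simp add: Qp_def FactRing_def)

lemma Qp_class_add:
  assumes "prime p" "pCauchy p X" "pCauchy p Y"
  shows "Qp_class p X \<oplus>\<^bsub>Qp p\<^esub> Qp_class p Y = Qp_class p (\<lambda>n. X n + Y n)"
proof -
  interpret I: ideal "pnull p" "pCauchy_ring p" by (rule pnull_ideal[OF assms(1)])
  show ?thesis using I.a_rcos_sum[of X Y] assms by (simp add: Qp_def FactRing_def)
qed

lemma Qp_class_mult:
  assumes "prime p" "pCauchy p X" "pCauchy p Y"
  shows "Qp_class p X \<otimes>\<^bsub>Qp p\<^esub> Qp_class p Y = Qp_class p (\<lambda>n. X n * Y n)"
proof -
  interpret I: ideal "pnull p" "pCauchy_ring p" by (rule pnull_ideal[OF assms(1)])
  show ?thesis using I.rcoset_mult_add[of X Y] assms by (simp add: Qp_def FactRing_def)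
qed

lemma Qp_class_square:
  assumes "prime p" "pCauchy p X"
  shows "Qp_class p X [^]\<^bsub>Qp p\<^esub> (2::nat) = Qp_class p (\<lambda>n. (X n)\<^sup>2)"
proof -
  interpret field "Qp p" by (rule Qp_field[OF assms(1)])
  have "Qp_class p X \<in> carrier (Qp p)" using assms by (auto simp: Qp_carrier)
  then show ?thesis using Qp_class_mult[OF assms assms(2)]
    by (simp add: numeral_2_eq_2 power2_eq_square[unfolded numeral_2_eq_2])
qed

lemma Qp_class_eq_iff:
  assumes p: "prime p"
  shows "Qp_class p X = Qp_class p Y \<longleftrightarrow> (\<lambda>n. X n - Y n) \<in> pnull p"
proof
  assume eq: "Qp_class p X = Qp_class p Y"
  have "X \<in> Qp_class p X"
    unfolding pnull_rcos[OF p] mem_Collect_eq by (rule exI[of _ "\<lambda>n. 0"]) (simp add: pnull_def)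
  then have "X \<in> Qp_class p Y" by (simp only: eq)
  then obtain Z where "X = (\<lambda>n. Z n + Y n)" "Z \<in> pnull p"
    unfolding pnull_rcos[OF p] by blast
  then show "(\<lambda>n. X n - Y n) \<in> pnull p" by simp
next
  assume D: "(\<lambda>n. X n - Y n) \<in> pnull p"
  show "Qp_class p X = Qp_class p Y"
    unfolding pnull_rcos[OF p]
  proof (intro equalityI subsetI)
    fix W assume "W \<in> {\<lambda>n. Z n + X n |Z. Z \<in> pnull p}"
    then obtain Z where Z: "Z \<in> pnull p" "W = (\<lambda>n. Z n + X n)" by blast
    then show "W \<in> {\<lambda>n. Z n + Y n |Z. Z \<in> pnull p}"
      using pnull_add[OF p Z(1) D] by (intro CollectI exI[of _ "\<lambda>n. Z n + (X n - Y n)"]) simp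
  next
    fix W assume "W \<in> {\<lambda>n. Z n + Y n |Z. Z \<in> pnull p}"
    then obtain Z where Z: "Z \<in> pnull p" "W = (\<lambda>n. Z n + Y n)" by blast
    then show "W \<in> {\<lambda>n. Z n + X n |Z. Z \<in> pnull p}"
      using pnull_add[OF p Z(1) pnull_minus[OF D]]
      by (intro CollectI exI[of _ "\<lambda>n. Z n + - (X n - Y n)"]) simp
  qed
qed

lemma Qp_class_eq_zero_iff:
  assumes "prime p"
  shows "Qp_class p X = \<zero>\<^bsub>Qp p\<^esub> \<longleftrightarrow> X \<in> pnull p"
proof -
  have "\<zero>\<^bsub>Qp p\<^esub> = Qp_class p (\<lambda>n. 0)"
    unfolding Qp_zero pnull_rcos[OF assms] by simp
  then show ?thesis using Qp_class_eq_iff[OF assms, of X "\<lambda>n. 0"] by simp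
qed

lemma Qp_of_rat_eq_zero_iff:
  assumes p: "prime p"
  shows "Qp_of_rat p q = \<zero>\<^bsub>Qp p\<^esub> \<longleftrightarrow> q = 0"
proof -
  have "(\<lambda>n. q) \<in> pnull p \<longleftrightarrow> q = 0"
    using pabs_pos[OF p, of q] by (cases "q = 0") (auto simp: pnull_def LIMSEQ_const_iff)
  then show ?thesis unfolding Qp_of_rat_def by (simp only: Qp_class_eq_zero_iff[OF p])
qed

lemma Qp_of_rat_carrier: "Qp_of_rat p q \<in> carrier (Qp p)"
  by (auto simp: Qp_carrier Qp_of_rat_def pCauchy_const)

lemma Qp_of_rat_mult:
  "prime p \<Longrightarrow> Qp_of_rat p q \<otimes>\<^bsub>Qp p\<^esub> Qp_of_rat p r = Qp_of_rat p (q * r)"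
  unfolding Qp_of_rat_def by (rule Qp_class_mult) (auto simp: pCauchy_const)

lemma Qp_of_rat_add:
  "prime p \<Longrightarrow> Qp_of_rat p q \<oplus>\<^bsub>Qp p\<^esub> Qp_of_rat p r = Qp_of_rat p (q + r)"
  unfolding Qp_of_rat_def by (rule Qp_class_add) (auto simp: pCauchy_const)

lemma Qp_of_rat_square:
  "prime p \<Longrightarrow> Qp_of_rat p q [^]\<^bsub>Qp p\<^esub> (2::nat) = Qp_of_rat p (q\<^sup>2)"
  unfolding Qp_of_rat_def by (rule Qp_class_square) (auto simp: pCauchy_const)

lemma Qp_of_rat_diff:
  assumes p: "prime p"
  shows "Qp_of_rat p q \<ominus>\<^bsub>Qp p\<^esub> Qp_of_rat p r = Qp_of_rat p (q - r)"
proof -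
  interpret field "Qp p" by (rule Qp_field[OF p])
  have "Qp_of_rat p q = Qp_of_rat p (q - r) \<oplus>\<^bsub>Qp p\<^esub> Qp_of_rat p r"
    by (simp add: Qp_of_rat_add[OF p])
  then show ?thesis
    using Qp_of_rat_carrier by (simp add: minus_eq a_assoc r_neg)
qed

lemma hilbert_symbol_eq_1_if_rational_point:
  assumes p: "prime p" and v: "(x, y, z) \<noteq> (0, 0, 0)" "a * x\<^sup>2 + b * y\<^sup>2 = z\<^sup>2"
  shows "hilbert_symbol p (Qp_of_rat p a) (Qp_of_rat p b) = 1"
proof -
  have "\<exists>x\<in>carrier (Qp p). \<exists>y\<in>carrier (Qp p). \<exists>z\<in>carrier (Qp p).
           (x, y, z) \<noteq> (\<zero>\<^bsub>Qp p\<^esub>, \<zero>\<^bsub>Qp p\<^esub>, \<zero>\<^bsub>Qp p\<^esub>) \<and>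
           z [^]\<^bsub>Qp p\<^esub> (2::nat) =
             Qp_of_rat p a \<otimes>\<^bsub>Qp p\<^esub> x [^]\<^bsub>Qp p\<^esub> (2::nat) \<oplus>\<^bsub>Qp p\<^esub> Qp_of_rat p b \<otimes>\<^bsub>Qp p\<^esub> y [^]\<^bsub>Qp p\<^esub> (2::nat)"
    using v
    by (intro bexI[of _ "Qp_of_rat p x"] bexI[of _ "Qp_of_rat p y"] bexI[of _ "Qp_of_rat p z"])
       (auto simp: Qp_of_rat_carrier Qp_of_rat_eq_zero_iff[OF p] Qp_of_rat_square[OF p]
          Qp_of_rat_mult[OF p] Qp_of_rat_add[OF p])
  then show ?thesis unfolding hilbert_symbol_def by (rule if_P)
qed

text \<open>
  The valuation is eventually constant along a Cauchy sequence that is not null.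
\<close>

lemma not_pnull_imp_bounded_below:
  assumes p: "prime p" and X: "pCauchy p X" "X \<notin> pnull p"
  shows "\<exists>\<delta>>0. \<forall>\<^sub>F n in sequentially. \<delta> \<le> rat_pabs p (X n)"
proof -
  obtain k where k: "\<forall>Z\<in>pnull p. \<forall>\<^sub>F n in sequentially. Z n + X n \<noteq> 0 \<and> rat_val p (Z n + X n) = k"
    using val_const[OF assms] by blast
  have "\<forall>\<^sub>F n in sequentially. 0 + X n \<noteq> 0 \<and> rat_val p (0 + X n) = k"
    by (rule bspec[OF k, of "\<lambda>n. 0"]) (simp add: pnull_def)
  then have "\<forall>\<^sub>F n in sequentially. real p powi (- k) \<le> rat_pabs p (X n)"
    by eventually_elim (simp add: rat_pabs_def)
  moreover have "real p powi (- k) > 0" using prime_gt_0_nat[OF p] by simp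
  ultimately show ?thesis by blast
qed

text \<open>
  Terms far out in Cauchy sequences representing the coordinates of a \<open>p\<close>-adic point are the required
  rational approximations.
\<close>

lemma hilbert_symbol_eq_1_imp_isotropic:
  assumes p: "prime p" and h: "hilbert_symbol p (Qp_of_rat p a) (Qp_of_rat p b) = 1"
  shows "padically_isotropic p a b (- 1)"
proof -
  have "\<exists>x\<in>carrier (Qp p). \<exists>y\<in>carrier (Qp p). \<exists>z\<in>carrier (Qp p).
           (x, y, z) \<noteq> (\<zero>\<^bsub>Qp p\<^esub>, \<zero>\<^bsub>Qp p\<^esub>, \<zero>\<^bsub>Qp p\<^esub>) \<and>
           z [^]\<^bsub>Qp p\<^esub> (2::nat) =
             Qp_of_rat p a \<otimes>\<^bsub>Qp p\<^esub> x [^]\<^bsub>Qp p\<^esub> (2::nat) \<oplus>\<^bsub>Qp p\<^esub> Qp_of_rat p b \<otimes>\<^bsub>Qp p\<^esub> y [^]\<^bsub>Qp p\<^esub> (2::nat)"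
    using h unfolding hilbert_symbol_def by (auto split: if_splits)
  then obtain x y z where xyz: "x \<in> carrier (Qp p)" "y \<in> carrier (Qp p)" "z \<in> carrier (Qp p)"
     "(x, y, z) \<noteq> (\<zero>\<^bsub>Qp p\<^esub>, \<zero>\<^bsub>Qp p\<^esub>, \<zero>\<^bsub>Qp p\<^esub>)"
     "z [^]\<^bsub>Qp p\<^esub> (2::nat) =
             Qp_of_rat p a \<otimes>\<^bsub>Qp p\<^esub> x [^]\<^bsub>Qp p\<^esub> (2::nat) \<oplus>\<^bsub>Qp p\<^esub> Qp_of_rat p b \<otimes>\<^bsub>Qp p\<^esub> y [^]\<^bsub>Qp p\<^esub> (2::nat)"
    by blast
  obtain X Y Z where C: "pCauchy p X" "pCauchy p Y" "pCauchy p Z"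
    and x: "x = Qp_class p X" and y: "y = Qp_class p Y" and z: "z = Qp_class p Z"
    using xyz(1-3) unfolding Qp_carrier by blast
  have C2: "pCauchy p (\<lambda>n. (W n)\<^sup>2)" if "pCauchy p W" for W
    using pCauchy_mult[OF p that that] by (simp add: power2_eq_square)
  have C3: "pCauchy p (\<lambda>n. q * (W n)\<^sup>2)" if "pCauchy p W" for q W
    by (rule pCauchy_mult[OF p pCauchy_const C2[OF that]])
  have "Qp_class p (\<lambda>n. (Z n)\<^sup>2) = Qp_class p (\<lambda>n. a * (X n)\<^sup>2 + b * (Y n)\<^sup>2)"
    using xyz(5) C unfolding x y z Qp_of_rat_def
    by (simp add: Qp_class_square[OF p] Qp_class_mult[OF p] Qp_class_add[OF p] pCauchy_const C2 C3)
  then have "(\<lambda>n. a * (X n)\<^sup>2 + b * (Y n)\<^sup>2 - (Z n)\<^sup>2) \<in> pnull p"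
    using Qp_class_eq_iff[OF p] by metis
  then have lim: "(\<lambda>n. rat_pabs p (a * (X n)\<^sup>2 + b * (Y n)\<^sup>2 + - 1 * (Z n)\<^sup>2)) \<longlonglongrightarrow> 0"
    by (simp add: pnull_def)
  have "X \<notin> pnull p \<or> Y \<notin> pnull p \<or> Z \<notin> pnull p"
    using xyz(4) unfolding x y z by (auto simp: Qp_class_eq_zero_iff[OF p])
  then have "(\<exists>\<delta>>0. \<forall>\<^sub>F n in sequentially. \<delta> \<le> rat_pabs p (X n)) \<or>
      (\<exists>\<delta>>0. \<forall>\<^sub>F n in sequentially. \<delta> \<le> rat_pabs p (Y n)) \<or>
      (\<exists>\<delta>>0. \<forall>\<^sub>F n in sequentially. \<delta> \<le> rat_pabs p (Z n))"
    using not_pnull_imp_bounded_below[OF p] C by blast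
  then have "\<exists>\<delta>>0. \<forall>\<^sub>F n in sequentially.
      \<delta> \<le> rat_pabs p (X n) \<or> \<delta> \<le> rat_pabs p (Y n) \<or> \<delta> \<le> rat_pabs p (Z n)"
    by (elim disjE exE conjE) (rule exI, erule conjI, erule eventually_mono, blast)+
  then obtain \<delta> where d: "\<delta> > 0" "\<forall>\<^sub>F n in sequentially.
      \<delta> \<le> rat_pabs p (X n) \<or> \<delta> \<le> rat_pabs p (Y n) \<or> \<delta> \<le> rat_pabs p (Z n)" by blast
  show ?thesis unfolding padically_isotropic_def
  proof (intro exI[of _ \<delta>] conjI allI impI d(1))
    fix e :: real assume "e > 0"
    then have "\<forall>\<^sub>F n in sequentially. rat_pabs p (a * (X n)\<^sup>2 + b * (Y n)\<^sup>2 + - 1 * (Z n)\<^sup>2) < e"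
      using lim by (auto intro: order_tendstoD)
    with d(2) have "\<forall>\<^sub>F n in sequentially.
      (\<delta> \<le> rat_pabs p (X n) \<or> \<delta> \<le> rat_pabs p (Y n) \<or> \<delta> \<le> rat_pabs p (Z n)) \<and>
      rat_pabs p (a * (X n)\<^sup>2 + b * (Y n)\<^sup>2 + - 1 * (Z n)\<^sup>2) < e" by eventually_elim blast
    then show "\<exists>x y z. (\<delta> \<le> rat_pabs p x \<or> \<delta> \<le> rat_pabs p y \<or> \<delta> \<le> rat_pabs p z) \<and>
      rat_pabs p (a * x\<^sup>2 + b * y\<^sup>2 + - 1 * z\<^sup>2) < e"
      by (blast dest: eventually_happens'[OF sequentially_bot])
  qed
qed

section \<open>The local-global principle\<close>

lemma Qp_val_of_int:
  "prime p \<Longrightarrow> t \<noteq> 0 \<Longrightarrow> Qp_val p (Qp_of_rat p (of_int t)) = int (multiplicity (int p) t)"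
  by (simp add: Qp_val_of_rat rat_val_of_int)

lemma Zp_cong_of_int:
  assumes p: "prime p" and m: "m \<noteq> 0" and cong: "m dvd u - w"
  shows "Zp_cong p (Qp_of_rat p (of_int u)) (Qp_of_rat p (of_int w)) m"
proof -
  obtain c where c: "u - w = m * c" using cong by blast
  have "Qp_of_rat p (of_int c) \<in> Zp p"
    using Qp_val_of_int[OF p, of c]
    by (cases "c = 0") (auto simp: Zp_def Qp_of_rat_carrier Qp_of_rat_eq_zero_iff[OF p])
  moreover have "Qp_of_rat p (of_int u) \<ominus>\<^bsub>Qp p\<^esub> Qp_of_rat p (of_int w)
      = Qp_of_rat p (of_int m) \<otimes>\<^bsub>Qp p\<^esub> Qp_of_rat p (of_int c)"
    unfolding Qp_of_rat_diff[OF p] Qp_of_rat_mult[OF p] using c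
    by (metis of_int_diff of_int_mult)
  ultimately show ?thesis unfolding Zp_cong_def by blast
qed

lemma Qp_unit_part_of_int:
  assumes p: "prime p" and u: "\<not> int p dvd u"
  shows "Qp_unit_part p (Qp_of_rat p (of_int (int p ^ i * u))) = Qp_of_rat p (of_int u)"
proof -
  have pp: "prime_elem (int p)" using p by simp
  have nz: "int p \<noteq> 0" "u \<noteq> 0" using u p by auto
  have "multiplicity (int p) (int p ^ i * u) = i"
    using u p nz by (simp add: prime_elem_multiplicity_mult_distrib[OF pp] not_dvd_imp_multiplicity_0
        multiplicity_same_power prime_elem_not_unit[OF pp])
  then have "Qp_val p (Qp_of_rat p (of_int (int p ^ i * u))) = int i"
    using Qp_val_of_int[OF p, of "int p ^ i * u"] nz by simp
  then show ?thesis unfolding Qp_unit_part_def Qp_of_rat_mult[OF p]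
    using nz by (simp add: power_int_minus power_int_of_nat field_simps)
qed

lemma squarefree_mult_imp_coprime:
  fixes x y :: int
  assumes "squarefree (x * y)"
  shows "coprime x y"
proof (rule coprimeI)
  fix d assume "d dvd x" "d dvd y"
  then have "d\<^sup>2 dvd x * y" by (simp add: power2_eq_square mult_dvd_mono)
  then show "is_unit d" by (rule squarefreeD[OF assms])
qed

text \<open>
  The odd part of \<open>m\<close> has a square that is 1 modulo 8, so passing from \<open>a * m^2\<close> to its unit part leaves
  the class of \<open>a\<close> modulo 4.
\<close>

lemma Qp_unit_part_2_square_mult:
  assumes a: "odd a" and m: "m \<noteq> 0"
  obtains u where "4 dvd u - a" "Qp_unit_part 2 (Qp_of_rat 2 (of_int (a * m\<^sup>2))) = Qp_of_rat 2 (of_int u)"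
proof -
  obtain y where y: "m = 2 ^ multiplicity 2 m * y" "odd y"
    using multiplicity_decompose'[of m 2] m by auto
  obtain k where k: "y\<^sup>2 = 8 * k + 1" using odd_square_mod_8[OF y(2)] by blast
  define i where "i = 2 * multiplicity 2 m"
  have "m\<^sup>2 = 2 ^ i * y\<^sup>2"
    unfolding i_def by (subst y(1)) (simp only: power_mult_distrib power_mult mult.commute[of 2])
  then have "a * m\<^sup>2 = int 2 ^ i * (a * y\<^sup>2)" by simp
  moreover have "\<not> int 2 dvd a * y\<^sup>2" using a y(2) by simp
  ultimately have "Qp_unit_part 2 (Qp_of_rat 2 (of_int (a * m\<^sup>2))) = Qp_of_rat 2 (of_int (a * y\<^sup>2))"
    using Qp_unit_part_of_int[OF two_is_prime_nat] by metis
  moreover have "4 dvd a * y\<^sup>2 - a"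
  proof -
    have "a * y\<^sup>2 - a = 4 * (2 * a * k)" by (simp add: k algebra_simps)
    then show ?thesis by (rule dvdI)
  qed
  ultimately show ?thesis using that by blast
qed

text \<open>
  Write \<open>t1 = g * A * m^2\<close> and \<open>t2 = g * B * n^2\<close> with \<open>g * A\<close> and \<open>g * B\<close> squarefree and \<open>A\<close>, \<open>B\<close>
  coprime. With \<open>C = - g\<close> the form \<open>t1 x^2 + t2 y^2 - z^2\<close> is \<open>g\<close> times the form with coefficients
  \<open>A\<close>, \<open>B\<close>, \<open>C\<close> after rescaling the variables, and \<open>A * B * C\<close> is squarefree. The valuation of \<open>t1\<close> at \<open>p\<close>
  is odd exactly if \<open>p\<close> divides \<open>g * A\<close>, and likewise for \<open>t2\<close>.
\<close>

lemma rational_point_if_no_hilbert_obstruction: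
  fixes t1 t2 :: int
  assumes t: "t1 \<noteq> 0" "t2 \<noteq> 0"
    and h: "\<And>p. prime p \<Longrightarrow> hilbert_symbol' p (Qp_of_rat p (of_int t1)) (Qp_of_rat p (of_int t2)) \<noteq> - 1"
  shows "\<exists>x y z :: rat. (x, y, z) \<noteq> (0, 0, 0) \<and> of_int t1 * x ^ 2 + of_int t2 * y ^ 2 = z ^ 2"
proof -
  define a where "a = squarefree_part t1"
  define m where "m = square_part t1"
  define b where "b = squarefree_part t2"
  define n where "n = square_part t2"
  have t1: "t1 = a * m\<^sup>2" and t2: "t2 = b * n\<^sup>2"
    unfolding a_def m_def b_def n_def by (rule squarefree_decompose)+
  have nz: "a \<noteq> 0" "b \<noteq> 0" "m \<noteq> 0" "n \<noteq> 0" using t t1 t2 by auto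
  define g where "g = gcd a b"
  obtain A B where A: "a = g * A" and B: "b = g * B" and AB: "coprime A B"
    using gcd_coprime_exists[of a b] nz unfolding g_def by (metis gcd_eq_0_iff mult.commute)
  define C where "C = - g"
  have g: "g \<noteq> 0" using nz by (simp add: g_def)
  have sqf: "squarefree (A * B * C)"
  proof -
    have "squarefree (g * A)" "squarefree (g * B)" unfolding A[symmetric] B[symmetric] a_def b_def by auto
    then have "coprime g A" "coprime g B" "squarefree A" "squarefree B" "squarefree g"
      by (auto dest: squarefree_mult_imp_coprime squarefree_multD)
    then have "squarefree (A * B * g)" using AB
      by (intro squarefree_mult_coprime) (auto simp: coprime_commute)
    then show ?thesis by (simp add: C_def)
  qed
  have isotropic: "padically_isotropic p (of_int A) (of_int B) (of_int C)"
    if p: "prime p" and h1: "hilbert_symbol p (Qp_of_rat p (of_int t1)) (Qp_of_rat p (of_int t2)) = 1" for p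
  proof (rule padically_isotropic_similar[OF p])
    show "padically_isotropic p (of_int g * of_int A * (of_int m)\<^sup>2) (of_int g * of_int B * (of_int n)\<^sup>2)
        (of_int g * of_int C * (1 / of_int g)\<^sup>2)"
      using hilbert_symbol_eq_1_imp_isotropic[OF p h1] g
      by (simp add: t1 t2 A B C_def power2_eq_square)
  qed (use nz g in auto)
  have val: "even (Qp_val p (Qp_of_rat p (of_int t1))) \<longleftrightarrow> \<not> int p dvd a"
    "even (Qp_val p (Qp_of_rat p (of_int t2))) \<longleftrightarrow> \<not> int p dvd b" if p: "prime p" for p
  proof -
    have *: "even (Qp_val p (Qp_of_rat p (of_int t))) \<longleftrightarrow> \<not> int p dvd squarefree_part t" if "t \<noteq> 0" for t
    proof -
      have "even (Qp_val p (Qp_of_rat p (of_int t))) \<longleftrightarrow> multiplicity (int p) (squarefree_part t) = 0"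
        using p that by (simp add: Qp_val_of_int prime_multiplicity_squarefree_part flip: even_iff_mod_2_eq_zero)
      also have "\<dots> \<longleftrightarrow> \<not> int p dvd squarefree_part t"
        using p by (intro prime_elem_multiplicity_eq_zero_iff) auto
      finally show ?thesis .
    qed
    show "even (Qp_val p (Qp_of_rat p (of_int t1))) \<longleftrightarrow> \<not> int p dvd a"
      "even (Qp_val p (Qp_of_rat p (of_int t2))) \<longleftrightarrow> \<not> int p dvd b"
      unfolding a_def b_def by (rule *[OF t(1)] *[OF t(2)])+
  qed
  have tz: "Qp_of_rat p (of_int t1) \<noteq> \<zero>\<^bsub>Qp p\<^esub>" "Qp_of_rat p (of_int t2) \<noteq> \<zero>\<^bsub>Qp p\<^esub>" if "prime p" for p
    using t by (simp_all add: Qp_of_rat_eq_zero_iff[OF that])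
  have h_cases: "hilbert_symbol p x y = 1 \<or> hilbert_symbol p x y = - 1" for p x y
    by (simp add: hilbert_symbol_def)
  have loc: "primitive_zero_mod p k A B C" if p: "prime p" and dvd: "int p dvd A * B * C" for p k
  proof -
    have "int p dvd a \<or> int p dvd b"
      using dvd p unfolding A B C_def by (auto simp: prime_dvd_mult_iff)
    then have "hilbert_symbol' p (Qp_of_rat p (of_int t1)) (Qp_of_rat p (of_int t2))
        = hilbert_symbol p (Qp_of_rat p (of_int t1)) (Qp_of_rat p (of_int t2))"
      unfolding hilbert_symbol'_def using tz[OF p] val[OF p] by auto
    then have "hilbert_symbol p (Qp_of_rat p (of_int t1)) (Qp_of_rat p (of_int t2)) = 1"
      using h[OF p] h_cases by metis
    then show ?thesis
      using padically_isotropic_imp_primitive_zero_mod[OF p isotropic[OF p]] by blast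
  qed
  have two: "4 dvd A + B \<or> 4 dvd B + C \<or> 4 dvd C + A" if odd: "odd (A * B * C)"
  proof (cases "hilbert_symbol 2 (Qp_of_rat 2 (of_int t1)) (Qp_of_rat 2 (of_int t2)) = 1")
    case True
    then have "primitive_zero_mod 2 2 A B C"
      using padically_isotropic_imp_primitive_zero_mod isotropic two_is_prime_nat by blast
    then show ?thesis using odd primitive_zero_mod_4 by simp
  next
    case False
    then have "hilbert_symbol 2 (Qp_of_rat 2 (of_int t1)) (Qp_of_rat 2 (of_int t2)) = - 1"
      using h_cases by metis
    with h[OF two_is_prime_nat] have ncong:
      "\<not> Zp_cong 2 (Qp_unit_part 2 (Qp_of_rat 2 (of_int t1))) (Qp_unit_part 2 (Qp_of_rat 2 (of_int t2))) 4"
      unfolding hilbert_symbol'_def using tz[OF two_is_prime_nat] by (auto split: if_splits)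
    have odds: "odd g" "odd A" "odd B" "odd a" "odd b" using odd by (simp_all add: C_def A B)
    obtain u where u: "4 dvd u - a" "Qp_unit_part 2 (Qp_of_rat 2 (of_int t1)) = Qp_of_rat 2 (of_int u)"
      using Qp_unit_part_2_square_mult[OF odds(4) nz(3)] unfolding t1 by metis
    obtain w where w: "4 dvd w - b" "Qp_unit_part 2 (Qp_of_rat 2 (of_int t2)) = Qp_of_rat 2 (of_int w)"
      using Qp_unit_part_2_square_mult[OF odds(5) nz(4)] unfolding t2 by metis
    have "\<not> 4 dvd u - w"
      using ncong Zp_cong_of_int[OF two_is_prime_nat, of 4 u w] unfolding u(2) w(2) by auto
    \<comment> \<open>Two odd numbers that differ modulo 4: one of them is 1.\<close>
    then have "4 dvd a - 1 \<or> 4 dvd b - 1"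
      using u(1) w(1) odds(4,5) by presburger
    \<comment> \<open>Modulo 4, an odd \<open>g\<close> is its own inverse.\<close>
    moreover have "4 dvd X - g" if "4 dvd g * X - 1" for X
    proof -
      obtain k where k: "g\<^sup>2 = 8 * k + 1" using odd_square_mod_8[OF odds(1)] by blast
      have "g * (X - g) = (g * X - 1) - 4 * (2 * k)"
        using k by (simp add: algebra_simps power2_eq_square)
      then have "4 dvd g * (X - g)" using that by simp
      moreover have "coprime (2\<^sup>2) g" using odds(1) by (simp only: coprime_power_left_iff coprime_left_2_iff_odd) simp
      then have "coprime 4 g" by simp
      ultimately show ?thesis by (simp add: coprime_dvd_mult_right_iff)
    qed
    ultimately have "4 dvd A - g \<or> 4 dvd B - g" unfolding A B by blast
    then show ?thesis unfolding C_def by auto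
  qed
  obtain x y z where v: "(x, y, z) \<noteq> (0, 0, 0)" "A * x\<^sup>2 + B * y\<^sup>2 + C * z\<^sup>2 = 0"
    using legendre_without_sign_condition[OF sqf loc two] by blast
  have "of_int t1 * (of_int x / of_int m)\<^sup>2 + of_int t2 * (of_int y / of_int n)\<^sup>2
      = (of_int (g * (A * x\<^sup>2 + B * y\<^sup>2)) :: rat)"
    using nz by (simp add: t1 t2 A B power_divide algebra_simps)
  also have "g * (A * x\<^sup>2 + B * y\<^sup>2) = (g * z)\<^sup>2"
    using v(2) by (simp add: C_def power2_eq_square)
  finally have "of_int t1 * (of_int x / of_int m)\<^sup>2 + of_int t2 * (of_int y / of_int n)\<^sup>2 = (of_int (g * z) :: rat)\<^sup>2"
    by simp
  moreover have "(of_int x / of_int m, of_int y / of_int n, of_int (g * z)) \<noteq> (0::rat, 0::rat, 0::rat)"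
    using v(1) nz g by simp
  ultimately show ?thesis by blast
qed

lemma prod_of_0_1_2:
  fixes f :: "'a \<Rightarrow> int"
  assumes "finite S" "\<And>p. p \<in> S \<Longrightarrow> f p \<in> {0, 1, 2}"
  shows "(\<Prod>p\<in>S. f p) = 0 \<or> (\<exists>k::nat. (\<Prod>p\<in>S. f p) = 2 ^ k)"
  using assms
proof (induction S rule: finite_induct)
  case empty
  show ?case by (auto intro: exI[of _ 0])
next
  case (insert p S)
  then consider "f p = 0 \<or> (\<Prod>p\<in>S. f p) = 0" | k where "f p = 1" "(\<Prod>p\<in>S. f p) = 2 ^ k"
    | k where "f p = 2" "(\<Prod>p\<in>S. f p) = 2 ^ k" by blast
  then show ?case
    using insert(1,2) by cases (auto intro: exI[of _ "Suc _"] exI[of _ "_::nat"])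
qed

theorem lemma1p10:
  fixes t1 t2 :: int
  defines "factor \<equiv> \<lambda>p::nat. 1 + hilbert_symbol' p (Qp_of_rat p (of_int t1)) (Qp_of_rat p (of_int t2))"
  defines "S \<equiv> {p. prime p \<and> factor p \<noteq> 1}"
  shows "finite S
    \<and> ((\<Prod>p\<in>S. factor p) = 0 \<or> (\<exists>k::nat. (\<Prod>p\<in>S. factor p) = 2 ^ k))
    \<and> ((\<Prod>p\<in>S. factor p) \<noteq> 0 \<longleftrightarrow>
         (\<exists>x y z :: rat. (x, y, z) \<noteq> (0, 0, 0) \<and> of_int t1 * x ^ 2 + of_int t2 * y ^ 2 = z ^ 2))"
proof -
  let ?h = "\<lambda>p. hilbert_symbol' p (Qp_of_rat p (of_int t1)) (Qp_of_rat p (of_int t2))"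
  have fin: "finite S"
  proof (cases "t1 = 0 \<or> t2 = 0")
    case True
    then have "factor p = 1" if "prime p" for p
      using that by (auto simp: factor_def hilbert_symbol'_def Qp_of_rat_eq_zero_iff)
    then have "S = {}" by (auto simp: S_def)
    then show ?thesis by simp
  next
    case False
    have "S \<subseteq> insert 2 (nat ` {d. d dvd t1 * t2})"
    proof
      fix p assume "p \<in> S"
      then have p: "prime p" and h: "?h p \<noteq> 0" by (auto simp: S_def factor_def)
      have ev: "even (Qp_val p (Qp_of_rat p (of_int t)))" if "\<not> int p dvd t" "t \<noteq> 0" for t
        using that by (simp add: Qp_val_of_int[OF p] not_dvd_imp_multiplicity_0)
      have "p = 2 \<or> int p dvd t1 \<or> int p dvd t2"
        using h ev False prime_odd_nat[OF p] prime_ge_2_nat[OF p] unfolding hilbert_symbol'_def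
        by (auto split: if_splits simp: le_less)
      then show "p \<in> insert 2 (nat ` {d. d dvd t1 * t2})"
        by (auto intro!: image_eqI[of _ _ "int p"])
    qed
    moreover have "finite {d. d dvd t1 * t2}" using False by (intro finite_divisors_int) auto
    ultimately show ?thesis by (auto intro: finite_subset)
  qed
  have range: "?h p \<in> {- 1, 0, 1}" for p
    by (simp add: hilbert_symbol'_def hilbert_symbol_def)
  have "(\<Prod>p\<in>S. factor p) \<noteq> 0 \<longleftrightarrow> (\<forall>p\<in>S. factor p \<noteq> 0)"
    using fin by (simp add: prod_zero_iff)
  also have "\<dots> \<longleftrightarrow> (\<forall>p. prime p \<longrightarrow> ?h p \<noteq> - 1)"
    by (auto simp: S_def factor_def)
  also have "\<dots> \<longleftrightarrow> (\<exists>x y z :: rat. (x, y, z) \<noteq> (0, 0, 0) \<and> of_int t1 * x ^ 2 + of_int t2 * y ^ 2 = z ^ 2)"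
  proof
    assume local: "\<forall>p. prime p \<longrightarrow> ?h p \<noteq> - 1"
    consider "t1 = 0" | "t2 = 0" | "t1 \<noteq> 0" "t2 \<noteq> 0" by blast
    then show "\<exists>x y z :: rat. (x, y, z) \<noteq> (0, 0, 0) \<and> of_int t1 * x ^ 2 + of_int t2 * y ^ 2 = z ^ 2"
    proof cases
      case 1
      then show ?thesis by (intro exI[of _ 1] exI[of _ 0]) simp
    next
      case 2
      then show ?thesis by (intro exI[of _ 0] exI[of _ 1] exI[of _ 0]) simp
    next
      case 3
      then show ?thesis using rational_point_if_no_hilbert_obstruction local by blast
    qed
  next
    assume "\<exists>x y z :: rat. (x, y, z) \<noteq> (0, 0, 0) \<and> of_int t1 * x ^ 2 + of_int t2 * y ^ 2 = z ^ 2"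
    then obtain x y z :: rat where v: "(x, y, z) \<noteq> (0, 0, 0)" "of_int t1 * x ^ 2 + of_int t2 * y ^ 2 = z ^ 2"
      by blast
    show "\<forall>p. prime p \<longrightarrow> ?h p \<noteq> - 1"
    proof (intro allI impI)
      fix p :: nat assume "prime p"
      from hilbert_symbol_eq_1_if_rational_point[OF this v] show "?h p \<noteq> - 1"
        unfolding hilbert_symbol'_def by simp
    qed
  qed
  finally have "(\<Prod>p\<in>S. factor p) \<noteq> 0 \<longleftrightarrow>
      (\<exists>x y z :: rat. (x, y, z) \<noteq> (0, 0, 0) \<and> of_int t1 * x ^ 2 + of_int t2 * y ^ 2 = z ^ 2)" .
  moreover have "(\<Prod>p\<in>S. factor p) = 0 \<or> (\<exists>k::nat. (\<Prod>p\<in>S. factor p) = 2 ^ k)"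
  proof (rule prod_of_0_1_2[OF fin])
    show "factor p \<in> {0, 1, 2}" for p using range[of p] by (auto simp: factor_def)
  qed
  ultimately show ?thesis using fin by blast
qed

end
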